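(* Let $p$ be a prime number and $\Psi=\Psi_p$. (1) The function $\Psi$ is bounded and uniformly continuous on any $p$-adic strip $\Sigma_\rho$, $\rho>0$, around $\mathbb{Q}_p$. In particular, $\Psi(x)\in\mathscr{H}^{\mathrm{bd}}$. (2) For any $j=0,1,\dots$ and any $x\in\mathbb{Q}_p$, $$\Psi_p(x+p^j\mathbb{C}_p^\circ)\subset\Psi_p(x)+p^j\mathbb{C}_p^\circ .$$
   Context: $\mathbb{C}_p$ is the completion of an algebraic closure of $\mathbb{Q}_p$ and $\mathbb{C}_p^\circ$ is its closed unit disc. $\Psi_p(T) \in T + T^2\mathbb{Z}[[T]]$ is the unique power series of this form satisfying $\sum_{j=0}^\infty p^{-j}\Psi_p(p^jT)^{p^j} = T$; it is $p$-adically entire. For $\rho>0$, the $p$-adic strip $\Sigma_\rho$ of width $\rho$ around $\mathbb{Q}_p$ is the analytic domain of the affine line which is the union of all affinoid (closed) discs of radius $\rho$ centered at points of $\mathbb{Q}_p$. $\mathscr{H}^{\mathrm{bd}}(\rho)$ is the ring of entire functions $f\in\mathbb{Q}_p\{x\}$ (power series over $\mathbb{Q}_p$ converging on all of $\mathbb{C}_p$) which are bounded on $\Sigma_\rho$, and $\mathscr{H}^{\mathrm{bd}}=\bigcap_{\rho>0}\mathscr{H}^{\mathrm{bd}}(\rho)$. *)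

theory Defs
  imports
    "HOL-Analysis.Analysis"
    "HOL-Computational_Algebra.Computational_Algebra"
begin

text \<open>
  The library reserves \<open>norm\<close> for real normed vector spaces, hence the separate absolute value.
  Its definiteness and the triangle inequality are contained in the axioms of metric spaces.
\<close>

class nonarch_field = field_char_0 + metric_space +
  fixes absv :: "'a \<Rightarrow> real"
  assumes dist_absv: "dist x y = absv (x - y)"
    and absv_mult: "absv (x * y) = absv x * absv y"
    and absv_add_le: "absv (x + y) \<le> max (absv x) (absv y)"

text \<open>
  In a complete field whose absolute value restricts to the $p$-adic one on the rationals, the
  topological closure of the prime field is the completion of the rationals, that is, the field
  of $p$-adic numbers.
\<close>

definition padic_numbers :: "'a::nonarch_field set" where
  "padic_numbers = closure (range of_rat)"

definition padic_algebraic :: "'a::nonarch_field set" where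
  "padic_algebraic =
     {x. \<exists>P. P \<noteq> 0 \<and> (\<forall>i. coeff P i \<in> padic_numbers) \<and> poly P x = 0}"

text \<open>
  The completion of an algebraic closure of the $p$-adic numbers is determined up to isometric
  isomorphism; the following says that the type is such a completion: it is complete, the
  elements algebraic over the $p$-adic numbers form an algebraically closed field (hence an
  algebraic closure of the $p$-adic numbers), and they are dense. The absolute value is
  normalized so that $p$ has absolute value $1/p$.
\<close>

definition is_padic_complex_field :: "nat \<Rightarrow> 'a::nonarch_field itself \<Rightarrow> bool" where
  "is_padic_complex_field p _ \<longleftrightarrow>
     (\<forall>n::int. n \<noteq> 0 \<longrightarrow> absv (of_int n :: 'a) = 1 / real p ^ multiplicity (int p) n) \<and>
     complete (UNIV :: 'a set) \<and>
     (\<forall>P :: 'a poly. degree P > 0 \<and> (\<forall>i. coeff P i \<in> padic_algebraic) \<longrightarrow>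
        (\<exists>x \<in> padic_algebraic. poly P x = 0)) \<and>
     closure (padic_algebraic :: 'a set) = UNIV"

definition padic_strip :: "real \<Rightarrow> 'a::nonarch_field set" where
  "padic_strip \<rho> = (\<Union>a \<in> padic_numbers. cball a \<rho>)"

definition fps_entire :: "'a::nonarch_field fps \<Rightarrow> bool" where
  "fps_entire f \<longleftrightarrow> (\<forall>x. summable (\<lambda>n. fps_nth f n * x ^ n))"

definition fps_value :: "'a::nonarch_field fps \<Rightarrow> 'a \<Rightarrow> 'a" where
  "fps_value f x = (\<Sum>n. fps_nth f n * x ^ n)"

definition Hbd_width :: "real \<Rightarrow> 'a::nonarch_field fps set" where
  "Hbd_width \<rho> = {f. (\<forall>n. fps_nth f n \<in> padic_numbers) \<and> fps_entire f \<and>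
     bounded (fps_value f ` padic_strip \<rho>)}"

definition Hbd :: "'a::nonarch_field fps set" where
  "Hbd = (\<Inter>\<rho> \<in> {0<..}. Hbd_width \<rho>)"

definition fps_of_int_coeffs :: "int fps \<Rightarrow> 'a::ring_1 fps" where
  "fps_of_int_coeffs F = Abs_fps (\<lambda>n. of_int (fps_nth F n))"

text \<open>
  The series in the functional equation is summed over the rationals in the $T$-adic topology,
  which is the topology of the metric on formal power series: as \<open>F\<close> has no constant term, the
  \<open>j\<close>-th summand is divisible by $T^{p^j}$.
\<close>

definition Psi_fps :: "nat \<Rightarrow> int fps" where
  "Psi_fps p = (THE F. fps_nth F 0 = 0 \<and> fps_nth F 1 = 1 \<and>
     (\<lambda>j. fps_const (1 / of_nat p ^ j) *
          (fps_of_int_coeffs F oo (fps_const (of_nat p ^ j) * fps_X)) ^ (p ^ j))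
       sums (fps_X :: rat fps))"

definition Psi :: "nat \<Rightarrow> 'a::nonarch_field \<Rightarrow> 'a" where
  "Psi p = fps_value (fps_of_int_coeffs (Psi_fps p))"

end

theory Submission
  imports Defs "HOL-Number_Theory.Residues"
begin

text \<open>
  Everything follows from the functional equation in the form
  $\Psi(x) = x - \sum_{j \ge 1} p^{-j}\Psi(p^jx)^{p^j}$, whose right-hand side involves $\Psi$ only at
  smaller arguments. On coefficients it is a recursion over the integers, and it propagates bounds
  for $\Psi$ from a disc to the $p$ times larger disc, so $\Psi$ is entire. Since
  $y \equiv z$ modulo $p^m$ with $m \ge 1$ implies $y^{p^j} \equiv z^{p^j}$ modulo $p^{m+j}$, and
  $y^{p^j} \equiv y^{p^{j+1}}$ modulo $p^{j+1}$ for $p$-adic integers $y$, it also shows, by induction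
  on the size of the argument, that $\Psi$ maps the $p$-adic numbers to $p$-adic integers and is
  1-Lipschitz at scale 1 around them. Wider strips are reached by one more induction on the width.
\<close>

subsection \<open>The integral power series\<close>

text \<open>The obstacle is the denominator p^j. If Psi(p^j x) is merely known to be integral, the
  j-th summand may have size p^j, so even boundedness on Q_p does not follow from estimating
  summands one at a time; it takes a comparison of two instances of the functional equation. That
  comparison needs y^p = y modulo p, which holds for p-adic integers but fails on the unit disc of
  C_p. Bounds off Q_p therefore come from differences to a point of Q_p, and Q_p is stable under
  multiplication by p^j, so the base points stay in it. For differences the denominator is harmless:
  if h has size at most 1, then p^j h with j >= 1 has size at most 1/p, the threshold below which
  each p-th power gains a factor 1/p. The j-fold gain cancels p^j exactly, so nothing is lost at
  width 1, and the inclusion of discs is this constant 1. On wider strips finitely many summands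
  fall outside this regime; a crude factor is accepted there, since boundedness and uniform
  continuity tolerate one.\<close>

text \<open>For F without constant term this is the coefficient of T^n in p^{-j} F(p^j T)^{p^j},
  visibly an integer. The truncated subtraction at n = 0 is harmless because F^(p^j) then has no
  constant term either.\<close>

definition Psi_term :: "nat \<Rightarrow> int fps \<Rightarrow> nat \<Rightarrow> nat \<Rightarrow> int" where
  "Psi_term p F j n = int p ^ (j * (n - 1)) * fps_nth (F ^ (p ^ j)) n"

text \<open>The functional equation in degree n, solved for its summand j = 0, which is the
  coefficient of F itself. The sum may stop at j = n since n < p^j for larger j.\<close>

definition Psi_step :: "nat \<Rightarrow> int fps \<Rightarrow> int fps" where
  "Psi_step p F =
     Abs_fps (\<lambda>n. if n = 0 then 0 else of_bool (n = 1) - (\<Sum>j=1..n. Psi_term p F j n))"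

lemma fps_of_int_coeffs_power:
  "fps_of_int_coeffs F ^ k = (fps_of_int_coeffs (F ^ k) :: 'a::comm_ring_1 fps)"
proof (induction k)
  case 0
  show ?case by (rule fps_ext) (simp add: fps_of_int_coeffs_def)
next
  case (Suc k)
  show ?case unfolding power_Suc Suc
    by (rule fps_ext) (simp add: fps_of_int_coeffs_def fps_mult_nth)
qed

lemma Psi_term_eq_0:
  assumes "fps_nth F 0 = 0" "n < p ^ j"
  shows "Psi_term p F j n = 0"
  using startsby_zero_power_prefix[OF assms(1), of "p ^ j"] assms(2) by (simp add: Psi_term_def)

text \<open>T-adic convergence means that each coefficient of the partial sums is eventually
  constant. Coefficient n is final once J > n, so the limit becomes an exact identity of integers in
  every degree.\<close>

lemma functional_equation_iff:
  assumes p: "2 \<le> p" and F0: "fps_nth F 0 = 0"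
  shows "(\<lambda>j. fps_const (1 / of_nat p ^ j) *
            (fps_of_int_coeffs F oo (fps_const (of_nat p ^ j) * fps_X)) ^ (p ^ j))
           sums (fps_X :: rat fps) \<longleftrightarrow> F = Psi_step p F"
    (is "?s sums _ \<longleftrightarrow> _")
proof -
  have p0: "of_nat p \<noteq> (0::rat)" using p by simp
  have nth: "fps_nth (?s j) n = of_int (Psi_term p F j n)" for j n
  proof -
    have "(fps_of_int_coeffs F oo (fps_const (of_nat p ^ j) * fps_X)) ^ (p ^ j)
        = ((fps_of_int_coeffs (F ^ (p ^ j))) oo (fps_const (of_nat p ^ j) * fps_X) :: rat fps)"
      by (simp flip: fps_of_int_coeffs_power add: fps_compose_power)
    then have "fps_nth (?s j) n
      = 1 / of_nat p ^ j * ((of_nat p ^ j) ^ n * of_int (fps_nth (F ^ (p ^ j)) n))"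
      by (simp add: fps_compose_linear fps_of_int_coeffs_def)
    also have "\<dots> = of_int (Psi_term p F j n)"
    proof (cases n)
      case 0
      have "p ^ j > 0" using p by simp
      then show ?thesis using F0 0 by (simp add: Psi_term_def startsby_zero_power)
    next
      case (Suc m)
      then show ?thesis using p0 by (simp add: Psi_term_def field_simps power_mult)
    qed
    finally show ?thesis .
  qed
  have stable: "fps_nth (\<Sum>j<J. ?s j) n = of_int (\<Sum>j\<le>n. Psi_term p F j n)" if "n < J" for J n
  proof -
    have "fps_nth (\<Sum>j<J. ?s j) n = of_int (\<Sum>j<J. Psi_term p F j n)"
      by (simp only: fps_sum_nth nth of_int_sum)
    also have "(\<Sum>j<J. Psi_term p F j n) = (\<Sum>j\<le>n. Psi_term p F j n)"
    proof (rule sum.mono_neutral_right)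
      show "\<forall>j\<in>{..<J} - {..n}. Psi_term p F j n = 0"
      proof
        fix j assume "j \<in> {..<J} - {..n}"
        moreover have "j < p ^ j" using p by (intro power_gt_expt) simp
        ultimately show "Psi_term p F j n = 0"
          using p F0 by (intro Psi_term_eq_0) auto
      qed
    qed (use that in auto)
    finally show ?thesis .
  qed
  have "?s sums fps_X \<longleftrightarrow>
      (\<forall>n. eventually (\<lambda>J. fps_nth (\<Sum>j<J. ?s j) n = fps_nth fps_X n) sequentially)"
    by (simp only: sums_def tendsto_fps_iff)
  also have "\<dots> \<longleftrightarrow> (\<forall>n. (\<Sum>j\<le>n. Psi_term p F j n) = of_bool (n = 1))"
  proof (rule iff_allI)
    fix n
    have "eventually (\<lambda>J. fps_nth (\<Sum>j<J. ?s j) n = fps_nth fps_X n) sequentially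
       \<longleftrightarrow> eventually (\<lambda>J. (of_int (\<Sum>j\<le>n. Psi_term p F j n)::rat) = fps_nth fps_X n) sequentially"
      by (rule eventually_cong, rule eventually_gt_at_top[of n], subst stable, auto)
    also have "\<dots> \<longleftrightarrow> (of_int (\<Sum>j\<le>n. Psi_term p F j n)::rat) = of_int (of_bool (n = 1))"
      by (simp add: of_bool_def)
    finally show "eventually (\<lambda>J. fps_nth (\<Sum>j<J. ?s j) n = fps_nth fps_X n) sequentially
       \<longleftrightarrow> (\<Sum>j\<le>n. Psi_term p F j n) = of_bool (n = 1)"
      unfolding of_int_eq_iff .
  qed
  also have "\<dots> \<longleftrightarrow> (\<forall>n. fps_nth F n = fps_nth (Psi_step p F) n)"
  proof (rule iff_allI)
    fix n
    have "(\<Sum>j\<le>n. Psi_term p F j n) = fps_nth F n + (\<Sum>j=1..n. Psi_term p F j n)"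
      by (simp add: atMost_atLeast0 sum.atLeast_Suc_atMost Psi_term_def)
    then show "(\<Sum>j\<le>n. Psi_term p F j n) = of_bool (n = 1) \<longleftrightarrow>
        fps_nth F n = fps_nth (Psi_step p F) n"
      using F0 by (auto simp: Psi_step_def)
  qed
  also have "\<dots> \<longleftrightarrow> F = Psi_step p F" by (auto simp: fps_eq_iff)
  finally show ?thesis .
qed

text \<open>
  Coefficient \<open>n\<close> of $F^q$ with $q \ge 2$ only involves coefficients of \<open>F\<close> below \<open>n\<close>, which
  makes \<open>Psi_step\<close> a contraction in the $T$-adic topology.
\<close>

lemma fps_power_nth_cong:
  fixes F G :: "int fps"
  assumes "fps_nth F 0 = 0" "fps_nth G 0 = 0" and eq: "\<And>i. i < n \<Longrightarrow> fps_nth F i = fps_nth G i"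
  shows "m < n + k \<Longrightarrow> fps_nth (F ^ Suc k) m = fps_nth (G ^ Suc k) m"
proof (induction k arbitrary: m)
  case 0
  then show ?case using eq by simp
next
  case (Suc k)
  have "fps_nth F i * fps_nth (F ^ Suc k) (m - i) = fps_nth G i * fps_nth (G ^ Suc k) (m - i)"
    if "i \<le> m" for i
  proof (cases "i = 0 \<or> n \<le> i")
    case True
    have "fps_nth (H ^ Suc k) (m - i) = 0" if "fps_nth H 0 = 0" "i \<noteq> 0" for H :: "int fps"
      using startsby_zero_power_prefix[OF that(1), of "Suc k"] True Suc.prems that(2) by simp
    then show ?thesis using assms by (cases "i = 0") auto
  next
    case False
    then have "fps_nth F i = fps_nth G i"
      and "fps_nth (F ^ Suc k) (m - i) = fps_nth (G ^ Suc k) (m - i)"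
      using eq Suc.IH[of "m - i"] Suc.prems by (auto simp del: power_Suc)
    then show ?thesis by simp
  qed
  then show ?case unfolding power_Suc[of _ "Suc k"] fps_mult_nth by (intro sum.cong) auto
qed

text \<open>Only j >= 1 occurs in \<open>Psi_step\<close>, so every exponent p^j is at least 2 and
  coefficient n of the power sees nothing from degree n on.\<close>

lemma Psi_step_cong:
  assumes p: "2 \<le> p" and "fps_nth F 0 = 0" "fps_nth G 0 = 0"
    and "\<And>i. i < n \<Longrightarrow> fps_nth F i = fps_nth G i"
  shows "fps_nth (Psi_step p F) n = fps_nth (Psi_step p G) n"
proof -
  have "Psi_term p F j n = Psi_term p G j n" if "1 \<le> j" for j
  proof -
    have "j < p ^ j" using p by (intro power_gt_expt) simp
    then have "1 \<le> p ^ j - 1" "p ^ j = Suc (p ^ j - 1)" using that by simp_all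
    then obtain k where k: "p ^ j = Suc k" "1 \<le> k" by blast
    then show ?thesis
      unfolding Psi_term_def k using fps_power_nth_cong[where m = n and k = k, OF assms(2-4)] by simp
  qed
  then show ?thesis by (simp add: Psi_step_def)
qed

lemma Psi_step_nth_0: "fps_nth (Psi_step p F) 0 = 0"
  by (simp add: Psi_step_def)

lemma Psi_step_fixpoint_unique:
  assumes p: "2 \<le> p" and F: "F = Psi_step p F" and G: "G = Psi_step p G"
  shows "F = G"
proof (rule fps_ext)
  fix n
  have "fps_nth F 0 = 0" "fps_nth G 0 = 0" using F G Psi_step_nth_0 by metis+
  then show "fps_nth F n = fps_nth G n"
  proof (induction n rule: less_induct)
    case (less n)
    then show ?case using Psi_step_cong[OF p] F G by metis
  qed
qed

text \<open>Fixed-point iteration from 0: after m steps the coefficients below m no longer change,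
  and the diagonal collects them.\<close>

lemma Psi_step_fixpoint_exists:
  assumes p: "2 \<le> p"
  shows "\<exists>F. F = Psi_step p F"
proof -
  define A where "A m = (Psi_step p ^^ m) 0" for m
  have A0: "fps_nth (A m) 0 = 0" for m
    by (cases m) (simp_all add: A_def Psi_step_nth_0)
  have AS: "A (Suc m) = Psi_step p (A m)" for m by (simp add: A_def)
  have stable: "fps_nth (A m) i = fps_nth (A (Suc m)) i" if "i < m" for i m
    using that
  proof (induction m arbitrary: i)
    case (Suc m)
    then show ?case unfolding AS[of "Suc m"] unfolding AS[of m]
      by (intro Psi_step_cong[OF p]) (auto simp: A0 simp flip: AS)
  qed simp
  define F where "F = Abs_fps (\<lambda>n. fps_nth (A (Suc n)) n)"
  have FA: "fps_nth F i = fps_nth (A m) i" if "i < m" for i m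
    using that
  proof (induction m)
    case (Suc m)
    then show ?case using stable[of i m] by (cases "i = m") (auto simp: F_def)
  qed simp
  have "fps_nth F n = fps_nth (Psi_step p F) n" for n
  proof -
    have "fps_nth F n = fps_nth (Psi_step p (A n)) n" by (simp add: F_def AS)
    also have "\<dots> = fps_nth (Psi_step p F) n"
      using FA[of 0 1] FA A0 by (intro Psi_step_cong[OF p]) simp_all
    finally show ?thesis .
  qed
  then show ?thesis by (blast intro: fps_ext)
qed

lemma Psi_step_nth_1:
  assumes "2 \<le> p" "fps_nth F 0 = 0"
  shows "fps_nth (Psi_step p F) 1 = 1"
  using assms Psi_term_eq_0[of F 1 p 1] by (simp add: Psi_step_def)

text \<open>Gives the definite description its meaning: its candidates are fixed points of
  \<open>Psi_step\<close>, of which there is exactly one. From here on only the recursion is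
  used.\<close>

lemma Psi_fps_fixpoint:
  assumes p: "2 \<le> p"
  shows "Psi_fps p = Psi_step p (Psi_fps p)"
proof -
  obtain F where F: "F = Psi_step p F" using Psi_step_fixpoint_exists[OF p] ..
  have F0: "fps_nth F 0 = 0" using F Psi_step_nth_0 by metis
  have "Psi_fps p = F" unfolding Psi_fps_def
  proof (rule the_equality, intro conjI)
    show "fps_nth F 1 = 1" using Psi_step_nth_1[OF p F0] F by simp
  next
    fix G :: "int fps"
    assume "fps_nth G 0 = 0 \<and> fps_nth G 1 = 1 \<and>
      (\<lambda>j. fps_const (1 / of_nat p ^ j) *
          (fps_of_int_coeffs G oo (fps_const (of_nat p ^ j) * fps_X)) ^ (p ^ j))
       sums (fps_X :: rat fps)"
    then show "G = F"
      using functional_equation_iff[OF p, of G] Psi_step_fixpoint_unique[OF p _ F] by blast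
  qed (use functional_equation_iff[OF p F0] F F0 in auto)
  then show ?thesis using F by simp
qed

lemma Psi_fps_nth_0: "2 \<le> p \<Longrightarrow> fps_nth (Psi_fps p) 0 = 0"
  by (metis Psi_fps_fixpoint Psi_step_nth_0)

text \<open>After J summands the formal identity is exact in all degrees below p^J. The evaluation
  at points uses this for fixed J and varying n.\<close>

lemma sum_Psi_term:
  assumes p: "2 \<le> p" and "n < p ^ J"
  shows "(\<Sum>j<J. Psi_term p (Psi_fps p) j n) = of_bool (n = 1)"
proof (cases "n = 0")
  case True
  then show ?thesis using Psi_term_eq_0[OF Psi_fps_nth_0[OF p]] p by simp
next
  case False
  let ?t = "\<lambda>j. Psi_term p (Psi_fps p) j n"
  have zero: "?t j = 0" if "J \<le> j \<or> n < j" for j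
  proof (rule Psi_term_eq_0[OF Psi_fps_nth_0[OF p]])
    have "j < p ^ j" using p by (intro power_gt_expt) simp
    moreover have "p ^ J \<le> p ^ j" if "J \<le> j" using that p by (intro power_increasing) auto
    ultimately show "n < p ^ j" using that assms(2) by linarith
  qed
  \<comment> \<open>Either of J and n may be the larger, so both index ranges are compared with
    their intersection, outside of which all terms vanish.\<close>
  have "(\<Sum>j<J. ?t j) = (\<Sum>j\<in>{..<J} \<inter> {0..n}. ?t j)"
    by (rule sum.mono_neutral_right) (auto intro!: zero)
  also have "\<dots> = (\<Sum>j=0..n. ?t j)"
    by (rule sum.mono_neutral_left) (auto intro!: zero)
  also have "\<dots> = fps_nth (Psi_fps p) n + (\<Sum>j=1..n. ?t j)"
    by (simp add: sum.atLeast_Suc_atMost Psi_term_def)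
  also have "\<dots> = of_bool (n = 1)"
    using False by (subst Psi_fps_fixpoint[OF p]) (simp add: Psi_step_def)
  finally show ?thesis .
qed

subsection \<open>Non-archimedean analysis\<close>

lemma absv_zero [simp]: "absv (0::'a::nonarch_field) = 0"
  using dist_absv[of "0::'a" 0] by simp

lemma absv_nonneg [simp]: "0 \<le> absv (x::'a::nonarch_field)"
  using dist_absv[of x 0] zero_le_dist[of x 0] by simp

lemma absv_eq_0_iff [simp]: "absv (x::'a::nonarch_field) = 0 \<longleftrightarrow> x = 0"
  using dist_absv[of x 0] dist_eq_0_iff[of x 0] by simp

lemma absv_one [simp]: "absv (1::'a::nonarch_field) = 1"
  using absv_mult[of "1::'a" 1] absv_eq_0_iff[of "1::'a"] by simp

lemma absv_minus [simp]: "absv (- x) = absv (x::'a::nonarch_field)"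
  using dist_absv[of x 0] dist_absv[of 0 x] by (simp add: dist_commute)

lemma absv_minus_commute: "absv (x - y) = absv (y - x::'a::nonarch_field)"
  using absv_minus[of "x - y"] by simp

lemma absv_diff_le: "absv (x - y) \<le> max (absv x) (absv (y::'a::nonarch_field))"
  using absv_add_le[of x "- y"] by simp

lemma absv_power: "absv (x ^ n) = absv (x::'a::nonarch_field) ^ n"
  by (induction n) (simp_all add: absv_mult)

lemma absv_divide: "absv (x / y) = absv x / absv (y::'a::nonarch_field)"
proof (cases "y = 0")
  case False
  then have "absv (x / y) * absv y = absv x" by (simp flip: absv_mult)
  then show ?thesis using False by (simp add: field_simps)
qed simp

lemma absv_add_leI:
  "absv x \<le> B \<Longrightarrow> absv y \<le> B \<Longrightarrow> absv (x + y::'a::nonarch_field) \<le> B"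
  using absv_add_le[of x y] by linarith

lemma absv_diff_leI:
  "absv x \<le> B \<Longrightarrow> absv y \<le> B \<Longrightarrow> absv (x - y::'a::nonarch_field) \<le> B"
  using absv_diff_le[of x y] by linarith

lemma absv_sum_le:
  fixes f :: "'b \<Rightarrow> 'a::nonarch_field"
  assumes "0 \<le> B" "\<And>i. i \<in> A \<Longrightarrow> absv (f i) \<le> B"
  shows "absv (sum f A) \<le> B"
  using assms by (induction A rule: infinite_finite_induct) (auto intro: absv_add_leI)

lemma absv_of_int_le_one: "absv (of_int n :: 'a::nonarch_field) \<le> 1"
proof -
  have nat: "absv (of_nat m :: 'a) \<le> 1" for m
    by (induction m) (auto intro: absv_add_leI)
  show ?thesis
  proof (cases n rule: int_cases2)
    case (nonneg m)
    then show ?thesis using nat[of m] by simp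
  next
    case (nonpos m)
    then show ?thesis using nat[of m] by simp
  qed
qed

lemma tendsto_dist_le:
  fixes g :: "'b \<Rightarrow> real"
  assumes "(g \<longlongrightarrow> 0) F" "\<And>x. dist (f x) l \<le> g x"
  shows "(f \<longlongrightarrow> l) F"
  by (rule tendsto_dist_iff[THEN iffD2], rule tendsto_sandwich[OF _ _ tendsto_const assms(1)])
    (simp_all add: assms(2))

instance nonarch_field \<subseteq> topological_ab_group_add
proof
  fix a b :: "'a::nonarch_field"
  have a: "((\<lambda>x. fst x) \<longlongrightarrow> a) (nhds a \<times>\<^sub>F nhds b)" and b: "((\<lambda>x. snd x) \<longlongrightarrow> b) (nhds a \<times>\<^sub>F nhds b)"
    by (auto simp: filterlim_fst filterlim_snd)
  from tendsto_add[OF tendsto_dist_iff[THEN iffD1, OF a] tendsto_dist_iff[THEN iffD1, OF b]]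
  have "((\<lambda>x. dist (fst x) a + dist (snd x) b) \<longlongrightarrow> 0) (nhds a \<times>\<^sub>F nhds b)"
    by simp
  moreover have "dist (fst x + snd x) (a + b) \<le> dist (fst x) a + dist (snd x) b" for x
  proof -
    have eq: "fst x + snd x - (a + b) = (fst x - a) + (snd x - b)" by simp
    show ?thesis
      using absv_add_le[of "fst x - a" "snd x - b"] absv_nonneg[of "fst x - a"]
        absv_nonneg[of "snd x - b"]
      unfolding dist_absv eq by linarith
  qed
  ultimately show "((\<lambda>x. fst x + snd x) \<longlongrightarrow> a + b) (nhds a \<times>\<^sub>F nhds b)"
    by (rule tendsto_dist_le)
  have "((\<lambda>x. dist x a) \<longlongrightarrow> 0) (nhds a)"
    by (rule tendsto_dist_iff[THEN iffD1, OF filterlim_ident])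
  moreover have "dist (- x) (- a) \<le> dist x a" for x
    by (simp add: dist_absv absv_minus_commute)
  ultimately show "(uminus \<longlongrightarrow> - a) (nhds a)"
    by (rule tendsto_dist_le)
qed

instance nonarch_field \<subseteq> topological_semigroup_mult
proof
  fix a b :: "'a::nonarch_field"
  have "((\<lambda>x. fst x) \<longlongrightarrow> a) (nhds a \<times>\<^sub>F nhds b)" "((\<lambda>x. snd x) \<longlongrightarrow> b) (nhds a \<times>\<^sub>F nhds b)"
    by (auto simp: filterlim_fst filterlim_snd)
  note lim = this[THEN tendsto_dist_iff[THEN iffD1]]
  have "((\<lambda>x. dist (fst x) a * dist (snd x) b + absv a * dist (snd x) b + dist (fst x) a * absv b)
      \<longlongrightarrow> 0 * 0 + absv a * 0 + 0 * absv b) (nhds a \<times>\<^sub>F nhds b)"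
    by (intro tendsto_add tendsto_mult tendsto_const lim)
  then have "((\<lambda>x. dist (fst x) a * dist (snd x) b + absv a * dist (snd x) b + dist (fst x) a * absv b)
      \<longlongrightarrow> 0) (nhds a \<times>\<^sub>F nhds b)" by simp
  moreover have "dist (fst x * snd x) (a * b) \<le>
      dist (fst x) a * dist (snd x) b + absv a * dist (snd x) b + dist (fst x) a * absv b" for x
  proof -
    have eq: "fst x * snd x - a * b
        = ((fst x - a) * (snd x - b) + a * (snd x - b)) + (fst x - a) * b"
      by (simp add: algebra_simps)
    have add: "absv (u + v) \<le> absv u + absv v" for u v :: 'a
      using absv_add_le[of u v] absv_nonneg[of u] absv_nonneg[of v] by linarith
    show ?thesis unfolding dist_absv eq
      by (intro order_trans[OF add] add_mono) (simp_all add: absv_mult)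
  qed
  ultimately show "((\<lambda>x. fst x * snd x) \<longlongrightarrow> a * b) (nhds a \<times>\<^sub>F nhds b)"
    by (rule tendsto_dist_le)
qed

text \<open>
  The library states the following rules on \<open>sums\<close> for real normed vector spaces only.
\<close>

lemma nonarch_sums_diff:
  fixes f g :: "nat \<Rightarrow> 'a::nonarch_field"
  shows "f sums a \<Longrightarrow> g sums b \<Longrightarrow> (\<lambda>n. f n - g n) sums (a - b)"
  unfolding sums_def by (simp add: sum_subtractf tendsto_diff)

lemma nonarch_sums_mult:
  fixes f :: "nat \<Rightarrow> 'a::nonarch_field"
  shows "f sums a \<Longrightarrow> (\<lambda>n. c * f n) sums (c * a)"
  unfolding sums_def sum_distrib_left[symmetric] by (intro tendsto_mult tendsto_const)

lemma nonarch_sums_shift: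
  fixes f :: "nat \<Rightarrow> 'a::nonarch_field"
  assumes "f sums a"
  shows "(\<lambda>n. f (Suc n)) sums (a - f 0)"
proof -
  have "(\<lambda>N. (\<Sum>n<Suc N. f n) - f 0) \<longlonglongrightarrow> a - f 0"
    using assms unfolding sums_def by (intro tendsto_diff tendsto_const LIMSEQ_Suc)
  then show ?thesis unfolding sums_def by (simp add: sum.lessThan_Suc_shift del: sum.lessThan_Suc)
qed

lemma absv_limit_le:
  fixes f :: "nat \<Rightarrow> 'a::nonarch_field"
  assumes "f \<longlonglongrightarrow> a" "\<And>n. absv (f n) \<le> B"
  shows "absv a \<le> B"
proof -
  have "(\<lambda>n. dist (f n) 0) \<longlonglongrightarrow> dist a 0" using assms(1) by (intro tendsto_intros)
  then show ?thesis using assms(2) by (intro LIMSEQ_le_const2[of _ "absv a"]) (auto simp: dist_absv)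
qed

lemma absv_sums_le:
  fixes f :: "nat \<Rightarrow> 'a::nonarch_field"
  assumes "f sums a" "\<And>n. absv (f n) \<le> B"
  shows "absv a \<le> B"
proof -
  have "0 \<le> B" using assms(2)[of 0] absv_nonneg[of "f 0"] by linarith
  then show ?thesis
    using assms(2) by (intro absv_limit_le[OF assms(1)[unfolded sums_def]] absv_sum_le)
qed

lemma nonarch_summable:
  fixes f :: "nat \<Rightarrow> 'a::nonarch_field"
  assumes "complete (UNIV :: 'a set)" and lim: "(\<lambda>n. absv (f n)) \<longlonglongrightarrow> 0"
  shows "summable f"
proof -
  have "Cauchy (\<lambda>N. \<Sum>n<N. f n)"
  proof (rule CauchyI')
    fix e :: real assume "0 < e"
    \<comment> \<open>Half of \<open>e\<close>, because the ultrametric estimate of a block of terms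
      yields only a weak inequality.\<close>
    then have "\<forall>\<^sub>F n in sequentially. absv (f n) < e / 2"
      using order_tendstoD(2)[OF lim, of "e / 2"] by simp
    then obtain M where M: "\<And>n. M \<le> n \<Longrightarrow> absv (f n) < e / 2"
      by (auto simp: eventually_sequentially)
    have "dist (\<Sum>n<m. f n) (\<Sum>n<k. f n) < e" if "M \<le> m" "m < k" for m k
    proof -
      have "(\<Sum>n<k. f n) - (\<Sum>n<m. f n) = (\<Sum>n\<in>{..<k} - {..<m}. f n)"
        using that by (subst sum_diff) auto
      moreover have "absv (\<Sum>n\<in>{..<k} - {..<m}. f n) \<le> e / 2"
        using \<open>0 < e\<close> M that by (intro absv_sum_le) (auto intro!: less_imp_le)
      ultimately show ?thesis using \<open>0 < e\<close> by (simp add: dist_absv absv_minus_commute)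
    qed
    then show "\<exists>M. \<forall>m\<ge>M. \<forall>n>m. dist (\<Sum>n<m. f n) (\<Sum>n<n. f n) < e" by blast
  qed
  then obtain s where "(\<lambda>N. \<Sum>n<N. f n) \<longlonglongrightarrow> s"
    using assms(1) unfolding complete_def by auto
  then show ?thesis unfolding summable_def sums_def by blast
qed

lemma absv_power_diff_le:
  fixes a b :: "'a::nonarch_field"
  assumes "absv a \<le> M" "absv b \<le> M" "1 \<le> M"
  shows "absv (a ^ n - b ^ n) \<le> M ^ n * absv (a - b)"
proof (induction n)
  case (Suc n)
  have "a ^ Suc n - b ^ Suc n = a * (a ^ n - b ^ n) + (a - b) * b ^ n"
    by (simp add: algebra_simps)
  moreover have "absv (a * (a ^ n - b ^ n)) \<le> M ^ Suc n * absv (a - b)"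
    using mult_mono[OF assms(1) Suc] assms by (simp add: absv_mult mult.assoc)
  moreover have "absv ((a - b) * b ^ n) \<le> M ^ Suc n * absv (a - b)"
  proof -
    have "absv b ^ n \<le> M ^ n" using assms by (intro power_mono) auto
    also have "\<dots> \<le> M ^ Suc n" using assms by (intro power_increasing) auto
    finally show ?thesis by (simp add: absv_mult absv_power mult.commute mult_left_mono)
  qed
  ultimately show ?case using absv_add_leI by metis
qed simp

section \<open>The p-adic numbers as a closed subring\<close>

lemma of_rat_in_padic_numbers: "of_rat r \<in> padic_numbers"
  unfolding padic_numbers_def by (intro subsetD[OF closure_subset]) simp

lemma padic_numbers_binop:
  fixes x y :: "'a::nonarch_field"
  assumes x: "x \<in> padic_numbers" and y: "y \<in> padic_numbers"
  shows "x + y \<in> padic_numbers" "x * y \<in> padic_numbers"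
proof -
  obtain f where f: "\<And>n. f n \<in> range of_rat" "f \<longlonglongrightarrow> x"
    using x unfolding padic_numbers_def closure_sequential by blast
  obtain g where g: "\<And>n. g n \<in> range of_rat" "g \<longlonglongrightarrow> y"
    using y unfolding padic_numbers_def closure_sequential by blast
  have "f n + g n \<in> range of_rat \<and> f n * g n \<in> range of_rat" for n
    using f(1)[of n] g(1)[of n] by (auto simp flip: of_rat_add of_rat_mult)
  then show "x + y \<in> padic_numbers" "x * y \<in> padic_numbers"
    unfolding padic_numbers_def closure_sequential
    using tendsto_add[OF f(2) g(2)] tendsto_mult[OF f(2) g(2)]
    by (intro exI[of _ "\<lambda>n. f n + g n"] exI[of _ "\<lambda>n. f n * g n"]; simp)+
qed

lemma of_int_in_padic_numbers: "of_int n \<in> padic_numbers"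
  using of_rat_in_padic_numbers[of "of_int n"] by simp

lemma zero_one_in_padic_numbers: "0 \<in> padic_numbers" "1 \<in> padic_numbers"
  using of_int_in_padic_numbers[of 0] of_int_in_padic_numbers[of 1] by simp_all

lemma padic_numbers_power: "x \<in> padic_numbers \<Longrightarrow> x ^ n \<in> padic_numbers"
  by (induction n) (simp_all add: padic_numbers_binop zero_one_in_padic_numbers)

lemma padic_numbers_sums:
  assumes "\<And>n. f n \<in> padic_numbers" "f sums s"
  shows "s \<in> padic_numbers"
proof -
  have "(\<Sum>n<N. f n) \<in> padic_numbers" for N
    using assms(1) by (induction N) (simp_all add: padic_numbers_binop zero_one_in_padic_numbers)
  then show ?thesis
    using assms(2) closed_sequentially[of padic_numbers "\<lambda>N. \<Sum>n<N. f n" s]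
    unfolding sums_def padic_numbers_def by simp
qed

section \<open>Gauss norms and values of powers of series\<close>

text \<open>Submultiplicativity of the Gauss norm sup |a_n| r^n, stated with explicit bounds so that
  no supremum has to exist.\<close>

lemma gauss_bound_mult:
  fixes f g :: "'a::nonarch_field fps"
  assumes f: "\<And>n. absv (fps_nth f n) * r ^ n \<le> C" and g: "\<And>n. absv (fps_nth g n) * r ^ n \<le> D"
    and r: "0 < r"
  shows "absv (fps_nth (f * g) n) * r ^ n \<le> C * D"
proof -
  have C: "0 \<le> C" "0 \<le> D"
    using order_trans[OF _ f[of 0]] order_trans[OF _ g[of 0]] by simp_all
  have "absv (fps_nth f i * fps_nth g (n - i)) \<le> C * D / r ^ n" if "i \<le> n" for i
  proof -
    have "(absv (fps_nth f i) * r ^ i) * (absv (fps_nth g (n - i)) * r ^ (n - i)) \<le> C * D"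
      using f[of i] g[of "n - i"] r C by (intro mult_mono) auto
    moreover have "r ^ n = r ^ i * r ^ (n - i)" using that by (simp flip: power_add)
    ultimately show ?thesis using r by (simp add: absv_mult field_simps)
  qed
  then have "absv (fps_nth (f * g) n) \<le> C * D / r ^ n"
    unfolding fps_mult_nth using C r by (intro absv_sum_le) auto
  then show ?thesis using r by (simp add: field_simps)
qed

lemma gauss_bound_power:
  fixes f :: "'a::nonarch_field fps"
  assumes f: "\<And>n. absv (fps_nth f n) * r ^ n \<le> C" and r: "0 < r"
  shows "absv (fps_nth (f ^ k) n) * r ^ n \<le> C ^ k"
proof (induction k arbitrary: n)
  case (Suc k)
  then show ?case using gauss_bound_mult[OF f _ r] by simp
qed (cases n; simp)

text \<open>The product of the partial sums runs over a square of index pairs, the partial sum of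
  the product over the triangle i + l < N. Every pair in between contributes at most C D t^N with t
  = |y|/r < 1, and by the ultrametric inequality their number is irrelevant.\<close>

lemma fps_mult_value_sums:
  fixes f g :: "'a::nonarch_field fps"
  assumes f: "\<And>n. absv (fps_nth f n) * r ^ n \<le> C" and g: "\<And>n. absv (fps_nth g n) * r ^ n \<le> D"
    and r: "absv y < r"
    and a: "(\<lambda>n. fps_nth f n * y ^ n) sums a" and b: "(\<lambda>n. fps_nth g n * y ^ n) sums b"
  shows "(\<lambda>n. fps_nth (f * g) n * y ^ n) sums (a * b)"
proof -
  have r0: "0 < r" using r absv_nonneg[of y] by linarith
  have C: "0 \<le> C" "0 \<le> D"
    using order_trans[OF _ f[of 0]] order_trans[OF _ g[of 0]] by simp_all
  define t where "t = absv y / r"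
  have t: "0 \<le> t" "t < 1" using r r0 by (simp_all add: t_def)
  define h where "h i l = fps_nth f i * fps_nth g l * y ^ (i + l)" for i l
  have h_bound: "absv (h i l) \<le> C * D * t ^ (i + l)" for i l
  proof -
    have "absv (h i l) = (absv (fps_nth f i) * r ^ i) * (absv (fps_nth g l) * r ^ l) * t ^ (i + l)"
      using r0 by (simp add: h_def t_def absv_mult absv_power power_add power_divide field_simps)
    also have "\<dots> \<le> C * D * t ^ (i + l)"
      using f[of i] g[of l] r0 C t by (intro mult_mono) auto
    finally show ?thesis .
  qed
  let ?P = "\<lambda>N. (\<Sum>n<N. fps_nth f n * y ^ n) * (\<Sum>n<N. fps_nth g n * y ^ n)"
  let ?S = "\<lambda>N. \<Sum>n<N. fps_nth (f * g) n * y ^ n"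
  have dist: "dist (?S N) (?P N) \<le> C * D * t ^ N" for N
  proof -
    have "?S N = (\<Sum>k<N. \<Sum>i\<le>k. h i (k - i))"
      by (simp add: fps_mult_nth h_def sum_distrib_right atLeast0AtMost)
    also have "\<dots> = (\<Sum>(i, l)\<in>{(i, l). i + l < N}. h i l)"
      by (rule sum.triangle_reindex[symmetric])
    finally have S: "?S N = (\<Sum>(i, l)\<in>{(i, l). i + l < N}. h i l)" .
    have P: "?P N = (\<Sum>(i, l)\<in>{..<N} \<times> {..<N}. h i l)"
      by (simp add: sum_product sum.cartesian_product h_def power_add mult_ac)
    have "?P N - ?S N = (\<Sum>(i, l)\<in>{..<N} \<times> {..<N} - {(i, l). i + l < N}. h i l)"
      unfolding S P by (rule sum_diff[symmetric]) auto
    moreover have "absv (\<Sum>(i, l)\<in>{..<N} \<times> {..<N} - {(i, l). i + l < N}. h i l) \<le> C * D * t ^ N"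
    proof (rule absv_sum_le)
      fix z assume "z \<in> {..<N} \<times> {..<N} - {(i, l). i + l < N}"
      then obtain i l where z: "z = (i, l)" "N \<le> i + l" by auto
      have "C * D * t ^ (i + l) \<le> C * D * t ^ N"
        using t C z by (intro mult_left_mono power_decreasing) auto
      then show "absv (case z of (i, l) \<Rightarrow> h i l) \<le> C * D * t ^ N"
        using h_bound[of i l] z by simp
    qed (use C t in simp)
    ultimately show ?thesis
      unfolding dist_absv[of "?S N"] absv_minus_commute[of "?S N"] by simp
  qed
  have P: "?P \<longlonglongrightarrow> a * b" using a b unfolding sums_def by (rule tendsto_mult)
  have "(\<lambda>N. C * D * t ^ N) \<longlonglongrightarrow> C * D * 0"
    using t by (intro tendsto_mult tendsto_const LIMSEQ_realpow_zero) auto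
  from tendsto_add[OF this tendsto_dist_iff[THEN iffD1, OF P]]
  have "(\<lambda>N. C * D * t ^ N + dist (?P N) (a * b)) \<longlonglongrightarrow> 0" by simp
  moreover have "dist (?S N) (a * b) \<le> C * D * t ^ N + dist (?P N) (a * b)" for N
    using dist_triangle[of "?S N" "a * b" "?P N"] dist[of N] by linarith
  ultimately show ?thesis unfolding sums_def by (rule tendsto_dist_le)
qed

lemma fps_power_value_sums:
  fixes f :: "'a::nonarch_field fps"
  assumes f: "\<And>n. absv (fps_nth f n) * r ^ n \<le> C"
    and r: "absv y < r" and a: "(\<lambda>n. fps_nth f n * y ^ n) sums a"
  shows "(\<lambda>n. fps_nth (f ^ k) n * y ^ n) sums (a ^ k)"
proof (induction k)
  case 0
  have "(\<lambda>n. if n = 0 then 1 else 0) sums (1::'a)"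
    by (rule sums_single[of 0 "\<lambda>_. 1"])
  moreover have "(\<lambda>n. fps_nth (f ^ 0) n * y ^ n) = (\<lambda>n. if n = 0 then 1 else 0)"
    by auto
  ultimately show ?case by simp
next
  case (Suc k)
  have "0 < r" using r absv_nonneg[of y] by linarith
  then show ?case
    using fps_mult_value_sums[OF f gauss_bound_power[OF f] r a Suc] by simp
qed

subsection \<open>The function on the $p$-adic complex numbers\<close>

abbreviation (input) Psi_series :: "nat \<Rightarrow> 'a::nonarch_field fps" where
  "Psi_series p \<equiv> fps_of_int_coeffs (Psi_fps p)"

context
  fixes p :: nat
  assumes prime_p: "prime p"
    and K: "is_padic_complex_field p TYPE('a::nonarch_field)"
begin

lemma p_ge_2: "2 \<le> p"
  using prime_p prime_ge_2_nat by blast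

lemma real_p_gt_1: "1 < real p"
  using p_ge_2 by simp

lemma inverse_p_less_1: "1 / real p < 1"
  using real_p_gt_1 by simp

lemma absv_p_power: "absv (of_nat p ^ j :: 'a) = 1 / real p ^ j"
proof -
  have "int p \<noteq> 0" "\<not> is_unit (int p)" using p_ge_2 by simp_all
  then have "absv (of_int (int p) :: 'a) = 1 / real p ^ multiplicity (int p) (int p)"
    using K unfolding is_padic_complex_field_def by blast
  then show ?thesis using \<open>int p \<noteq> 0\<close> \<open>\<not> is_unit (int p)\<close>
    by (simp add: absv_power power_divide multiplicity_self)
qed

lemma of_nat_p_nonzero: "of_nat p \<noteq> (0::'a)"
  using p_ge_2 by simp

lemma absv_of_int_dvd:
  assumes "int p dvd n"
  shows "absv (of_int n :: 'a) \<le> 1 / real p"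
proof -
  from assms obtain m where "n = int p * m" by (elim dvdE)
  then have "absv (of_int n :: 'a) = absv (of_nat p ^ 1 :: 'a) * absv (of_int m :: 'a)"
    by (simp add: absv_mult)
  then show ?thesis
    using absv_of_int_le_one[of m, where 'a = 'a] real_p_gt_1
    by (simp only: absv_p_power) (simp add: field_simps)
qed

lemma absv_of_int_not_dvd: "\<not> int p dvd n \<Longrightarrow> absv (of_int n :: 'a) = 1"
  using K unfolding is_padic_complex_field_def
  by (cases "n = 0") (simp_all add: not_dvd_imp_multiplicity_0)

section \<open>Coefficient growth and entireness\<close>

lemma absv_Psi_series_le_one: "absv (fps_nth (Psi_series p :: 'a fps) n) \<le> 1"
  by (simp add: fps_of_int_coeffs_def absv_of_int_le_one)

lemma Psi_series_nth_0: "fps_nth (Psi_series p :: 'a fps) 0 = 0"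
  by (simp add: fps_of_int_coeffs_def Psi_fps_nth_0[OF p_ge_2])

lemma of_int_Psi_term:
  "of_int (Psi_term p (Psi_fps p) j n) =
     of_nat p ^ (j * (n - 1)) * fps_nth ((Psi_series p :: 'a fps) ^ (p ^ j)) n"
  unfolding fps_of_int_coeffs_power by (simp add: Psi_term_def fps_of_int_coeffs_def)

text \<open>
  In terms of Gauss norms: the summand $p^{-j}\Psi(p^jT)^{p^j}$ on the disc of radius $p^{k+1}$ is
  controlled by $\Psi$ on the disc of radius $p^{k+1-j}$. For $j > k+1$ the latter lies in the open
  unit disc, where the norm of $\Psi$ is at most the radius.
\<close>

lemma Psi_term_decay_step:
  assumes C: "\<And>n. absv (fps_nth (Psi_series p :: 'a fps) n) * (real p ^ k) ^ n \<le> C"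
    and "1 \<le> C" and j: "1 \<le> j"
  shows "absv (of_int (Psi_term p (Psi_fps p) j n) :: 'a) * (real p ^ Suc k) ^ n
    \<le> real p ^ Suc k * C ^ (p ^ Suc k)"
proof (cases "n = 0")
  case True
  then show ?thesis
    using Psi_term_eq_0[OF Psi_fps_nth_0[OF p_ge_2], of 0 p j] p_ge_2 \<open>1 \<le> C\<close> by simp
next
  case False
  then obtain m where n: "n = Suc m" by (cases n) auto
  have p0: "0 < real p" using real_p_gt_1 by simp
  let ?q = "p ^ j"
  \<comment> \<open>The radius p^(k+1-j), written as a quotient because the exponent may be
    negative. In \<open>eq\<close> the factor p^j is what remains of |p^(j(n-1))| after p^(-jn) has
    been absorbed into r^n.\<close>
  define r where "r = real p ^ Suc k / real p ^ j"
  have r0: "0 < r" using p0 by (simp add: r_def)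
  have eq: "absv (of_int (Psi_term p (Psi_fps p) j n) :: 'a) * (real p ^ Suc k) ^ n =
      real p ^ j * (absv (fps_nth ((Psi_series p :: 'a fps) ^ ?q) n) * r ^ n)"
    using p0 unfolding of_int_Psi_term absv_mult absv_p_power r_def n
    by (simp add: power_divide power_mult field_simps)
  have D: "1 \<le> C ^ (p ^ Suc k)" "1 \<le> real p ^ Suc k"
    using \<open>1 \<le> C\<close> real_p_gt_1 by (intro one_le_power; simp)+
  show ?thesis
  proof (cases "j \<le> Suc k")
    case True
    have "r \<le> real p ^ k"
      using real_p_gt_1 j by (simp add: r_def field_simps self_le_power)
    then have "absv (fps_nth (Psi_series p :: 'a fps) i) * r ^ i \<le> C" for i
      using r0 by (intro order_trans[OF _ C[of i]] mult_left_mono power_mono) auto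
    then have "absv (fps_nth ((Psi_series p :: 'a fps) ^ ?q) n) * r ^ n \<le> C ^ ?q"
      using r0 by (rule gauss_bound_power)
    also have "\<dots> \<le> C ^ (p ^ Suc k)"
      using True \<open>1 \<le> C\<close> p_ge_2 by (intro power_increasing) auto
    finally show ?thesis unfolding eq
      using True real_p_gt_1 r0 by (intro mult_mono power_increasing) auto
  next
    case False
    then have "real p ^ Suc (Suc k) \<le> real p ^ j"
      using real_p_gt_1 by (intro power_increasing) auto
    then have r: "r \<le> 1 / real p" using p0 by (simp add: r_def field_simps)
    then have r1: "r \<le> 1" using inverse_p_less_1 by linarith
    have "absv (fps_nth (Psi_series p :: 'a fps) i) * r ^ i \<le> r" for i
    proof (cases i)
      case 0
      then show ?thesis using r0 by (simp add: Psi_series_nth_0)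
    next
      case (Suc l)
      have "r ^ i \<le> r ^ 1" using r0 r1 Suc by (intro power_decreasing) auto
      then show ?thesis
        using mult_mono[OF absv_Psi_series_le_one[of i] \<open>r ^ i \<le> r ^ 1\<close>] r0 by simp
    qed
    then have "absv (fps_nth ((Psi_series p :: 'a fps) ^ ?q) n) * r ^ n \<le> r ^ ?q"
      using r0 by (rule gauss_bound_power)
    \<comment> \<open>The weaker exponent j suffices: r <= 1/p already makes r^j cancel the factor
      p^j.\<close>
    also have "r ^ ?q \<le> r ^ j"
      using r0 r1 p_ge_2 by (intro power_decreasing less_imp_le[OF power_gt_expt]) auto
    also have "r ^ j \<le> (1 / real p) ^ j" using r r0 by (intro power_mono) auto
    finally have "real p ^ j * (absv (fps_nth ((Psi_series p :: 'a fps) ^ ?q) n) * r ^ n) \<le> 1"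
      using p0 by (simp add: power_divide field_simps)
    also have "\<dots> \<le> real p ^ Suc k * C ^ (p ^ Suc k)"
      using mult_mono[OF D(2) D(1)] D by simp
    finally show ?thesis unfolding eq .
  qed
qed

text \<open>Finiteness of the Gauss norm on every disc. Integrality of the coefficients settles
  radius 1; the step bounds all summands by the worst case j = k+1, and the same constant dominates
  the norm p^(k+1) of T.\<close>

lemma Psi_series_decay:
  "\<exists>C\<ge>1. \<forall>n. absv (fps_nth (Psi_series p :: 'a fps) n) * (real p ^ k) ^ n \<le> C"
proof (induction k)
  case 0
  then show ?case using absv_Psi_series_le_one by auto
next
  case (Suc k)
  then obtain C where C: "1 \<le> C"
      "\<And>n. absv (fps_nth (Psi_series p :: 'a fps) n) * (real p ^ k) ^ n \<le> C" by blast
  define D where "D = real p ^ Suc k * C ^ (p ^ Suc k)"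
  have D: "1 \<le> C ^ (p ^ Suc k)" "1 \<le> real p ^ Suc k"
    using \<open>1 \<le> C\<close> real_p_gt_1 by (intro one_le_power; simp)+
  have pD: "real p ^ Suc k \<le> D"
    using mult_left_mono[OF D(1), of "real p ^ Suc k"] by (simp add: D_def)
  then have D1: "1 \<le> D" using D(2) by linarith
  have p0: "0 < (real p ^ Suc k) ^ n" for n using real_p_gt_1 by simp
  have bound: "absv (fps_nth (Psi_series p :: 'a fps) n) \<le> D / (real p ^ Suc k) ^ n" for n
  proof (cases "n = 0")
    case True
    then show ?thesis using D1 by (simp add: Psi_series_nth_0)
  next
    case False
    have "fps_nth (Psi_fps p) n = fps_nth (Psi_step p (Psi_fps p)) n"
      using Psi_fps_fixpoint[OF p_ge_2] by simp
    then have "fps_nth (Psi_series p :: 'a fps) n =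
        of_bool (n = 1) - (\<Sum>j=1..n. of_int (Psi_term p (Psi_fps p) j n))"
      using False by (simp add: fps_of_int_coeffs_def Psi_step_def of_bool_def)
    moreover have "absv (of_bool (n = 1) :: 'a) \<le> D / (real p ^ Suc k) ^ n"
      using pD D1 p0[of 1] by (cases "n = 1") (simp_all add: field_simps)
    moreover have "absv (\<Sum>j=1..n. of_int (Psi_term p (Psi_fps p) j n) :: 'a)
        \<le> D / (real p ^ Suc k) ^ n"
    proof (rule absv_sum_le)
      fix j assume "j \<in> {1..n}"
      then have "absv (of_int (Psi_term p (Psi_fps p) j n) :: 'a) * (real p ^ Suc k) ^ n \<le> D"
        unfolding D_def by (intro Psi_term_decay_step[OF C(2,1)]) simp
      then show "absv (of_int (Psi_term p (Psi_fps p) j n) :: 'a) \<le> D / (real p ^ Suc k) ^ n"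
        using p0[of n] by (simp only: pos_le_divide_eq)
    qed (use D1 in simp)
    ultimately show ?thesis using absv_diff_leI by metis
  qed
  have "absv (fps_nth (Psi_series p :: 'a fps) n) * (real p ^ Suc k) ^ n \<le> D" for n
    using bound[of n] p0[of n] by (simp only: pos_le_divide_eq)
  then show ?case using D1 by blast
qed

text \<open>Uniformity in j and n at once is the point: it controls the error of the functional
  equation at a point.\<close>

lemma Psi_term_decay:
  "\<exists>D\<ge>0. \<forall>j n. absv (of_int (Psi_term p (Psi_fps p) j n) :: 'a) * (real p ^ Suc k) ^ n \<le> D"
proof -
  obtain C where C: "1 \<le> C"
      "\<And>n. absv (fps_nth (Psi_series p :: 'a fps) n) * (real p ^ k) ^ n \<le> C"
    using Psi_series_decay by blast
  obtain C' where C': "1 \<le> C'"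
      "\<And>n. absv (fps_nth (Psi_series p :: 'a fps) n) * (real p ^ Suc k) ^ n \<le> C'"
    using Psi_series_decay by blast
  let ?D = "max C' (real p ^ Suc k * C ^ (p ^ Suc k))"
  have "absv (of_int (Psi_term p (Psi_fps p) j n) :: 'a) * (real p ^ Suc k) ^ n \<le> ?D" for j n
  proof (cases "j = 0")
    case True
    then show ?thesis using C'(2)[of n] unfolding of_int_Psi_term by simp
  next
    case False
    then show ?thesis using Psi_term_decay_step[OF C(2,1), of j n] by simp
  qed
  moreover have "0 \<le> ?D" using C' by simp
  ultimately show ?thesis by blast
qed

lemma p_power_exceeds: obtains k where "B < real p ^ Suc k"
proof -
  obtain n where "B < real p ^ n" using real_arch_pow[OF real_p_gt_1] by blast
  also have "\<dots> \<le> real p ^ Suc n" using real_p_gt_1 by (intro power_increasing) auto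
  finally show thesis by (rule that)
qed

lemma fps_entire_Psi_series: "fps_entire (Psi_series p :: 'a fps)"
  unfolding fps_entire_def
proof
  fix x :: 'a
  obtain k where k: "absv x < real p ^ Suc k" by (rule p_power_exceeds)
  obtain C where C: "1 \<le> C"
      "\<And>n. absv (fps_nth (Psi_series p :: 'a fps) n) * (real p ^ Suc k) ^ n \<le> C"
    using Psi_series_decay by blast
  define t where "t = absv x / real p ^ Suc k"
  have p0: "0 < real p ^ Suc k" using real_p_gt_1 by simp
  have t: "0 \<le> t" "t < 1" using k p0 by (simp_all add: t_def del: power_Suc)
  show "summable (\<lambda>n. fps_nth (Psi_series p :: 'a fps) n * x ^ n)"
  proof (rule nonarch_summable)
    show "complete (UNIV :: 'a set)" using K unfolding is_padic_complex_field_def by simp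
    have bound: "absv (fps_nth (Psi_series p :: 'a fps) n * x ^ n) \<le> C * t ^ n" for n
    proof -
      have "absv x ^ n = (real p ^ Suc k) ^ n * t ^ n"
        using p0 by (simp add: t_def power_divide del: power_Suc)
      then show ?thesis
        using mult_right_mono[OF C(2)[of n], of "t ^ n"] t
        by (simp only: absv_mult absv_power) (simp add: mult.assoc)
    qed
    have lim: "(\<lambda>n. C * t ^ n) \<longlonglongrightarrow> 0"
      using tendsto_mult[OF tendsto_const[of C] LIMSEQ_realpow_zero[OF t]] by simp
    show "(\<lambda>n. absv (fps_nth (Psi_series p :: 'a fps) n * x ^ n)) \<longlonglongrightarrow> 0"
      by (rule tendsto_sandwich[OF _ _ tendsto_const lim]) (simp_all add: bound)
  qed
qed

section \<open>The functional equation for values\<close>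

lemma Psi_sums: "(\<lambda>n. fps_nth (Psi_series p :: 'a fps) n * x ^ n) sums Psi p x"
  using fps_entire_Psi_series unfolding fps_entire_def Psi_def fps_value_def
  by (simp add: summable_sums)

lemma Psi_power_sums:
  "(\<lambda>n. fps_nth ((Psi_series p :: 'a fps) ^ k) n * x ^ n) sums Psi p x ^ k"
proof -
  obtain l where l: "absv x < real p ^ Suc l" by (rule p_power_exceeds)
  obtain C where C: "\<And>n. absv (fps_nth (Psi_series p :: 'a fps) n) * (real p ^ Suc l) ^ n \<le> C"
    using Psi_series_decay by blast
  show ?thesis by (rule fps_power_value_sums[OF C l Psi_sums])
qed

text \<open>No double series is rearranged: for fixed J the J-th partial sum minus x is a single
  power series in x, all of whose terms are at most D t^J. Those of degree below p^J vanish, and the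
  others have degree n >= J.\<close>

lemma Psi_functional_equation:
  "(\<lambda>j. Psi p (of_nat p ^ j * x) ^ (p ^ j) / of_nat p ^ j) sums (x::'a)"
proof -
  let ?T = "\<lambda>j n. of_int (Psi_term p (Psi_fps p) j n) :: 'a"
  have term_sums: "(\<lambda>n. ?T j n * x ^ n) sums (Psi p (of_nat p ^ j * x) ^ (p ^ j) / of_nat p ^ j)"
    for j
  proof -
    have "1 / of_nat p ^ j * (fps_nth ((Psi_series p :: 'a fps) ^ (p ^ j)) n * (of_nat p ^ j * x) ^ n)
        = ?T j n * x ^ n" for n
    proof (cases n)
      case 0
      then show ?thesis using p_ge_2 unfolding of_int_Psi_term
        by (simp add: fps_power_zeroth Psi_series_nth_0 zero_power)
    next
      case (Suc m)
      then show ?thesis using of_nat_p_nonzero unfolding of_int_Psi_term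
        by (simp add: power_mult_distrib power_mult field_simps)
    qed
    then show ?thesis
      using nonarch_sums_mult[OF Psi_power_sums[of "p ^ j" "of_nat p ^ j * x"], of "1 / of_nat p ^ j"]
      by simp
  qed
  have x_sums: "(\<lambda>n. of_bool (n = 1) * x ^ n) sums x"
  proof -
    have "(\<lambda>n. of_bool (n = 1) * x ^ n) = (\<lambda>n. if n = 1 then x ^ n else 0)" by auto
    then show ?thesis using sums_single[of 1 "\<lambda>n. x ^ n"] by simp
  qed
  obtain k where k: "absv x < real p ^ Suc k" by (rule p_power_exceeds)
  obtain D where D: "0 \<le> D" "\<And>j n. absv (?T j n) * (real p ^ Suc k) ^ n \<le> D"
    using Psi_term_decay by blast
  define t where "t = absv x / real p ^ Suc k"
  have p0: "0 < real p ^ Suc k" using real_p_gt_1 by simp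
  have t: "0 \<le> t" "t < 1" using k p0 by (simp_all add: t_def del: power_Suc)
  have tail: "absv ((\<Sum>j<J. ?T j n * x ^ n) - of_bool (n = 1) * x ^ n) \<le> D * t ^ J" for J n
  proof (cases "n < p ^ J")
    case True
    then have "(\<Sum>j<J. ?T j n) = of_bool (n = 1)"
      using sum_Psi_term[OF p_ge_2 True] by (simp flip: of_int_sum add: of_bool_def)
    then show ?thesis using D t by (simp flip: sum_distrib_right)
  next
    case False
    have "absv (\<Sum>j<N. ?T j n * x ^ n) \<le> D * t ^ n" for N
    proof (rule absv_sum_le)
      fix j
      have "absv x ^ n = (real p ^ Suc k) ^ n * t ^ n"
        using p0 by (simp add: t_def power_divide del: power_Suc)
      then show "absv (?T j n * x ^ n) \<le> D * t ^ n"
        using mult_right_mono[OF D(2)[of j n], of "t ^ n"] t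
        by (simp only: absv_mult absv_power) (simp add: mult.assoc)
    qed (use D t in simp)
    \<comment> \<open>The monomial T is itself a sum of the same terms, taken with J = n, and so
      obeys the same bound.\<close>
    moreover have "(\<Sum>j<n. ?T j n * x ^ n) = of_bool (n = 1) * x ^ n"
      using sum_Psi_term[OF p_ge_2, of n n] p_ge_2 power_gt_expt[of p n]
      by (simp flip: sum_distrib_right of_int_sum add: of_bool_def)
    ultimately have "absv ((\<Sum>j<J. ?T j n * x ^ n) - of_bool (n = 1) * x ^ n) \<le> D * t ^ n"
      by (metis absv_diff_leI)
    also have "J \<le> n" using False p_ge_2 power_gt_expt[of p J] by simp
    then have "D * t ^ n \<le> D * t ^ J"
      using t D by (intro mult_left_mono power_decreasing) auto
    finally show ?thesis .
  qed
  have "dist (\<Sum>j<J. Psi p (of_nat p ^ j * x) ^ (p ^ j) / of_nat p ^ j) x \<le> D * t ^ J" for J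
    unfolding dist_absv
    by (rule absv_sums_le[OF nonarch_sums_diff[OF sums_sum[OF term_sums] x_sums] tail])
  moreover have "(\<lambda>J. D * t ^ J) \<longlonglongrightarrow> 0"
    using tendsto_mult[OF tendsto_const[of D] LIMSEQ_realpow_zero[OF t]] by simp
  ultimately show ?thesis unfolding sums_def by (rule tendsto_dist_le[rotated])
qed

text \<open>The form in which the functional equation is used below: the summand j = 0 is isolated,
  the others involve only the smaller arguments p^j u and p^j v, and \<open>real p ^ j\<close> is
  the size of the inverted denominator.\<close>

lemma Psi_diff_le:
  fixes u v :: 'a
  assumes "absv (u - v) \<le> B"
    and "\<And>j. 1 \<le> j \<Longrightarrow> real p ^ j *
      absv (Psi p (of_nat p ^ j * u) ^ (p ^ j) - Psi p (of_nat p ^ j * v) ^ (p ^ j)) \<le> B"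
  shows "absv (Psi p u - Psi p v) \<le> B"
proof -
  let ?f = "\<lambda>u j. Psi p (of_nat p ^ j * u) ^ (p ^ j) / of_nat p ^ j :: 'a"
  have "(\<lambda>j. ?f u (Suc j) - ?f v (Suc j)) sums ((u - ?f u 0) - (v - ?f v 0))"
    by (intro nonarch_sums_diff nonarch_sums_shift Psi_functional_equation)
  moreover have "absv (?f u (Suc j) - ?f v (Suc j)) \<le> B" for j
    using assms(2)[of "Suc j"] unfolding diff_divide_distrib[symmetric] absv_divide absv_p_power
    by (simp add: mult.commute)
  ultimately have "absv ((u - ?f u 0) - (v - ?f v 0)) \<le> B" by (rule absv_sums_le)
  then have "absv ((u - v) - ((u - ?f u 0) - (v - ?f v 0))) \<le> B"
    using assms(1) by (rule absv_diff_leI[rotated])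
  then show ?thesis by simp
qed

section \<open>Congruences for p-th powers\<close>

text \<open>In the binomial expansion the middle coefficients are divisible by p. The last term d^p
  has no such factor; there the gain comes from |d|^(p-1) <= 1/p, which is where \<delta> <= 1/p
  enters.\<close>

lemma frobenius_contracts:
  fixes y z :: 'a
  assumes y: "absv y \<le> 1" and d: "absv (z - y) \<le> \<delta>" "\<delta> \<le> 1 / real p"
  shows "absv (z ^ p - y ^ p) \<le> \<delta> / real p"
proof -
  let ?d = "z - y"
  have \<delta>: "0 \<le> \<delta>" "\<delta> \<le> 1"
    using d absv_nonneg[of ?d] inverse_p_less_1 by linarith+
  have dk: "absv ?d ^ k \<le> \<delta>" if "1 \<le> k" for k
  proof -
    have "absv ?d ^ k \<le> \<delta> ^ k" using d by (intro power_mono) auto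
    also have "\<dots> \<le> \<delta> ^ 1" using \<delta> that by (intro power_decreasing) auto
    finally show ?thesis by simp
  qed
  have "z ^ p = (\<Sum>k=0..p. of_nat (p choose k) * ?d ^ k * y ^ (p - k))"
    using binomial_ring[of ?d y p] by (simp add: atMost_atLeast0)
  also have "\<dots> = y ^ p + (\<Sum>k=1..p. of_nat (p choose k) * ?d ^ k * y ^ (p - k))"
    by (simp add: sum.atLeast_Suc_atMost)
  finally have "z ^ p - y ^ p = (\<Sum>k=1..p. of_nat (p choose k) * ?d ^ k * y ^ (p - k))"
    by simp
  moreover have "absv (\<Sum>k=1..p. of_nat (p choose k) * ?d ^ k * y ^ (p - k)) \<le> \<delta> / real p"
  proof (rule absv_sum_le)
    fix k assume k: "k \<in> {1..p}"
    have yk: "absv (y ^ (p - k)) \<le> 1" using y by (simp add: absv_power power_le_one)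
    have "absv (of_nat (p choose k) * ?d ^ k) \<le> \<delta> / real p"
    proof (cases "k = p")
      case True
      have "absv ?d ^ p = absv ?d ^ (p - 1) * absv ?d" using p_ge_2 by (simp add: power_eq_if)
      also have "\<dots> \<le> (1 / real p) * \<delta>"
        using order_trans[OF dk[of "p - 1"] d(2)] d(1) p_ge_2 by (intro mult_mono) auto
      finally show ?thesis using True by (simp add: absv_power)
    next
      case False
      then have "int p dvd int (p choose k)"
        using k prime_p by (auto intro: dvd_choose_prime)
      then have "absv (of_int (int (p choose k)) :: 'a) \<le> 1 / real p" by (rule absv_of_int_dvd)
      then show ?thesis
        using mult_mono[OF _ dk[of k], of "absv (of_nat (p choose k) :: 'a)" "1 / real p"] k
        by (simp add: absv_mult absv_power)
    qed
    then show "absv (of_nat (p choose k) * ?d ^ k * y ^ (p - k)) \<le> \<delta> / real p"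
      using mult_mono[OF _ yk] \<delta> by (simp add: absv_mult[of _ "y ^ (p - k)"])
  qed (use \<delta> in simp)
  ultimately show ?thesis by simp
qed

lemma frobenius_power_contracts:
  fixes y z :: 'a
  assumes y: "absv y \<le> 1" and d: "absv (z - y) \<le> \<delta>" "\<delta> \<le> 1 / real p"
  shows "absv (z ^ (p ^ j) - y ^ (p ^ j)) \<le> \<delta> / real p ^ j"
proof (induction j)
  case 0
  then show ?case using d by simp
next
  case (Suc j)
  have "0 \<le> \<delta>" using d(1) absv_nonneg[of "z - y"] by linarith
  then have "\<delta> / real p ^ j \<le> \<delta>"
    using real_p_gt_1 by (simp add: divide_le_eq mult_le_cancel_left1)
  then have "\<delta> / real p ^ j \<le> 1 / real p" using d(2) by linarith
  moreover have "absv (y ^ (p ^ j)) \<le> 1" using y by (simp add: absv_power power_le_one)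
  ultimately have "absv ((z ^ (p ^ j)) ^ p - (y ^ (p ^ j)) ^ p) \<le> \<delta> / real p ^ j / real p"
    using Suc by (intro frobenius_contracts)
  then show ?case by (simp add: power_mult mult.commute flip: power_mult)
qed

text \<open>Fermat's congruence depends only on the class modulo p. This carries it from residues to
  all integers, and from rationals to their limits.\<close>

lemma fermat_perturb:
  fixes y z :: 'a
  assumes "absv (y ^ p - y) \<le> 1 / real p" "absv y \<le> 1" "absv (z - y) \<le> 1 / real p"
  shows "absv (z ^ p - z) \<le> 1 / real p"
proof -
  have "1 / real p / real p \<le> 1 / real p" using real_p_gt_1 by (simp add: field_simps)
  then have "absv (z ^ p - y ^ p) \<le> 1 / real p"
    using frobenius_contracts[OF assms(2,3)] by simp
  then have "absv (((z ^ p - y ^ p) + (y ^ p - y)) - (z - y)) \<le> 1 / real p"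
    using assms by (intro absv_diff_leI[of "_ + _"] absv_add_leI[of "_ - _"])
  then show ?thesis by simp
qed

lemma fermat_of_int: "absv (of_int n ^ p - of_int n :: 'a) \<le> 1 / real p"
proof (rule fermat_perturb)
  \<comment> \<open>Fermat's theorem is available for natural numbers, so n is replaced by its least
    nonnegative residue.\<close>
  define m where "m = nat (n mod int p)"
  have m: "int m = n mod int p" using p_ge_2 by (simp add: m_def)
  have "[m ^ p = m] (mod p)"
  proof (cases "p dvd m")
    case True
    moreover have "m dvd m ^ p" using p_ge_2 by (simp add: dvd_power)
    ultimately show ?thesis by (meson cong_0_iff cong_sym cong_trans dvd_trans)
  next
    case False
    have "[m ^ (p - 1) * m = 1 * m] (mod p)"
      by (intro cong_mult fermat_theorem[OF prime_p False] cong_refl)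
    then show ?thesis using p_ge_2 by (simp add: power_eq_if mult.commute)
  qed
  then have "int p dvd int m ^ p - int m"
    by (simp flip: cong_int_iff add: cong_iff_dvd_diff)
  from absv_of_int_dvd[OF this]
  show "absv (of_int (int m) ^ p - of_int (int m) :: 'a) \<le> 1 / real p" by simp
  show "absv (of_int (int m) :: 'a) \<le> 1" by (rule absv_of_int_le_one)
  have "int p dvd n - int m" unfolding m by (simp add: minus_mod_eq_mult_div)
  from absv_of_int_dvd[OF this]
  show "absv (of_int n - of_int (int m) :: 'a) \<le> 1 / real p" by simp
qed

text \<open>In lowest terms |r| <= 1 forces the denominator to be a p-adic unit, so clearing
  denominators reduces the claim to the two integers.\<close>

lemma fermat_of_rat:
  assumes "absv (of_rat r :: 'a) \<le> 1"
  shows "absv (of_rat r ^ p - of_rat r :: 'a) \<le> 1 / real p"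
proof -
  obtain a b where ab: "quotient_of r = (a, b)" by (cases "quotient_of r")
  let ?a = "of_int a :: 'a" and ?b = "of_int b :: 'a"
  have b: "b > 0" "coprime a b" and "r = of_int a / of_int b"
    using quotient_of_denom_pos[OF ab] quotient_of_coprime[OF ab] quotient_of_div[OF ab] by auto
  then have r: "(of_rat r :: 'a) = ?a / ?b" by (simp add: of_rat_divide)
  have "\<not> int p dvd b"
  proof
    assume dvd: "int p dvd b"
    have "\<not> int p dvd a"
    proof
      assume "int p dvd a"
      then have "is_unit (int p)" using dvd b(2) coprime_common_divisor by blast
      then show False using p_ge_2 by simp
    qed
    then have "absv (of_rat r :: 'a) = 1 / absv ?b"
      unfolding r absv_divide by (simp add: absv_of_int_not_dvd)
    moreover have "0 < absv ?b"
      using b(1) absv_nonneg[of ?b] absv_eq_0_iff[of ?b] by (simp add: less_le del: absv_eq_0_iff)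
    moreover have "absv ?b < 1"
      using absv_of_int_dvd[OF dvd] inverse_p_less_1 by linarith
    ultimately show False using assms by (simp add: field_simps)
  qed
  then have b1: "absv ?b = 1" by (rule absv_of_int_not_dvd)
  have b0: "?b \<noteq> 0" using b(1) by simp
  have "of_rat r ^ p - of_rat r = ((?a ^ p - ?a) * ?b - ?a * (?b ^ p - ?b)) / (?b ^ p * ?b)"
    unfolding r using b0 by (simp add: power_divide field_simps)
  moreover have "absv ((?a ^ p - ?a) * ?b - ?a * (?b ^ p - ?b)) \<le> 1 / real p"
  proof (rule absv_diff_leI)
    show "absv ((?a ^ p - ?a) * ?b) \<le> 1 / real p"
      using fermat_of_int[of a] by (simp add: absv_mult b1)
    show "absv (?a * (?b ^ p - ?b)) \<le> 1 / real p"
      using mult_mono[OF absv_of_int_le_one[of a] fermat_of_int[of b]] by (simp add: absv_mult)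
  qed
  ultimately show ?thesis by (simp add: absv_divide absv_mult absv_power b1)
qed

lemma fermat_padic_integer:
  fixes y :: 'a
  assumes "y \<in> padic_numbers" "absv y \<le> 1"
  shows "absv (y ^ p - y) \<le> 1 / real p"
proof -
  have p: "0 < 1 / real p" "1 / real p \<le> 1" using real_p_gt_1 by simp_all
  then obtain r where r: "dist (of_rat r) y < 1 / real p"
    using assms(1) unfolding padic_numbers_def closure_approachable by blast
  then have near: "absv (y - of_rat r) \<le> 1 / real p"
    unfolding dist_absv absv_minus_commute[of y] by simp
  have "absv (y - (y - of_rat r)) \<le> 1"
  proof (rule absv_diff_leI)
    show "absv (y - of_rat r) \<le> 1" using near p(2) by linarith
  qed fact
  then have "absv (of_rat r :: 'a) \<le> 1" by simp
  then show ?thesis using fermat_perturb[OF fermat_of_rat _ near] by blast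
qed

section \<open>Integrality on Q_p and the Lipschitz constant 1\<close>

text \<open>Fermat's congruence will be applied to values of Psi, which therefore must not only be
  integral but lie in Q_p.\<close>

lemma Psi_in_padic_numbers:
  assumes "x \<in> padic_numbers"
  shows "Psi p (x::'a) \<in> padic_numbers"
proof (rule padic_numbers_sums[OF _ Psi_sums])
  fix n
  have "fps_nth (Psi_series p :: 'a fps) n \<in> padic_numbers"
    by (simp add: fps_of_int_coeffs_def of_int_in_padic_numbers)
  then show "fps_nth (Psi_series p :: 'a fps) n * x ^ n \<in> padic_numbers"
    by (intro padic_numbers_binop padic_numbers_power assms)
qed

lemma p_power_mult_padic_numbers:
  "x \<in> padic_numbers \<Longrightarrow> of_nat p ^ j * (x::'a) \<in> padic_numbers"
  using padic_numbers_binop(2)[OF padic_numbers_power[OF of_int_in_padic_numbers[of "int p"]]]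
  by simp

text \<open>The exponent N is the measure of size on which the following inductions run.\<close>

lemma p_power_mult_small: obtains N where "absv (of_nat p ^ N * (x::'a)) \<le> 1"
proof -
  obtain k where k: "absv x < real p ^ Suc k" by (rule p_power_exceeds)
  have "0 < real p ^ Suc k" using real_p_gt_1 by simp
  then have "absv (of_nat p ^ Suc k * x) \<le> 1"
    using k unfolding absv_mult absv_p_power by (simp add: field_simps)
  then show thesis by (rule that)
qed

text \<open>
  Comparing the functional equation at $x$ with $1/p$ times the one at $px$ expresses $\Psi(x)$
  through the values $y_j = \Psi(p^{j+1}x)$ as
  $\sum_j p^{-j-1} (y_j^{p^j} - y_j^{p^{j+1}})$, whose terms are integral when the $y_j$ are.
\<close>

lemma absv_Psi_le_one:
  fixes x :: 'a
  assumes "x \<in> padic_numbers"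
  shows "absv (Psi p x) \<le> 1"
proof -
  obtain N where "absv (of_nat p ^ N * x) \<le> 1" by (rule p_power_mult_small)
  then show ?thesis using assms
  proof (induction N arbitrary: x)
    case 0
    have "absv (fps_nth (Psi_series p :: 'a fps) n * x ^ n) \<le> 1" for n
      using mult_mono[OF absv_Psi_series_le_one[of n], of "absv x ^ n" 1] 0
      by (simp add: absv_mult absv_power power_le_one)
    then show ?case by (rule absv_sums_le[OF Psi_sums])
  next
    case (Suc N)
    let ?f = "\<lambda>j. Psi p (of_nat p ^ j * x) ^ (p ^ j) / of_nat p ^ j"
    let ?g = "\<lambda>j. Psi p (of_nat p ^ j * (of_nat p * x)) ^ (p ^ j) / of_nat p ^ j"
    have "(\<lambda>j. 1 / of_nat p * ?g j) sums (1 / of_nat p * (of_nat p * x))"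
      by (intro nonarch_sums_mult Psi_functional_equation)
    \<comment> \<open>The shift removes the summand j = 0, so the two copies of x cancel and Psi(x)
      alone is left.\<close>
    from nonarch_sums_diff[OF this nonarch_sums_shift[OF Psi_functional_equation]]
    have "(\<lambda>j. 1 / of_nat p * ?g j - ?f (Suc j)) sums
        (1 / of_nat p * (of_nat p * x) - (x - ?f 0))" .
    then have "(\<lambda>j. 1 / of_nat p * ?g j - ?f (Suc j)) sums Psi p x"
      using of_nat_p_nonzero by simp
    then show ?case
    proof (rule absv_sums_le)
      fix j
      define y where "y = Psi p (of_nat p ^ Suc j * x)"
      have "of_nat p ^ Suc j * x \<in> padic_numbers"
        using Suc.prems(2) by (rule p_power_mult_padic_numbers)
      moreover have "absv (of_nat p ^ N * (of_nat p ^ Suc j * x)) \<le> 1"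
      proof -
        have "of_nat p ^ N * (of_nat p ^ Suc j * x) = of_nat p ^ j * (of_nat p ^ Suc N * x)"
          by (simp add: mult_ac)
        moreover have "absv (of_nat p ^ j :: 'a) \<le> 1"
          unfolding absv_p_power using real_p_gt_1 by simp
        ultimately show ?thesis
          using mult_mono[of "absv (of_nat p ^ j :: 'a)" 1 "absv (of_nat p ^ Suc N * x)" 1] Suc.prems(1)
          by (simp only: absv_mult) simp
      qed
      ultimately have y: "y \<in> padic_numbers" "absv y \<le> 1"
        unfolding y_def by (auto intro: Psi_in_padic_numbers Suc.IH)
      \<comment> \<open>Frobenius contraction for the pair y^p and y, which are congruent modulo p:
        this supplies the extra power of p beyond j.\<close>
      have "absv ((y ^ p) ^ (p ^ j) - y ^ (p ^ j)) \<le> 1 / real p / real p ^ j"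
        by (rule frobenius_power_contracts[OF y(2) fermat_padic_integer[OF y]]) simp
      then have "absv (y ^ (p ^ j) - y ^ (p ^ Suc j)) \<le> 1 / real p ^ Suc j"
        by (simp add: absv_minus_commute flip: power_mult)
      then have "absv ((y ^ (p ^ j) - y ^ (p ^ Suc j)) / of_nat p ^ Suc j) \<le> 1"
        unfolding absv_divide absv_p_power using real_p_gt_1
        by (simp add: field_simps)
      moreover have "1 / of_nat p * ?g j - ?f (Suc j)
          = (y ^ (p ^ j) - y ^ (p ^ Suc j)) / of_nat p ^ Suc j"
        using of_nat_p_nonzero by (simp add: y_def diff_divide_distrib mult_ac)
      ultimately show "absv (1 / of_nat p * ?g j - ?f (Suc j)) \<le> 1" by simp
    qed
  qed
qed

lemma Psi_lipschitz_unit_disc: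
  fixes u h :: 'a
  assumes "absv u \<le> 1" "absv h \<le> 1"
  shows "absv (Psi p (u + h) - Psi p u) \<le> absv h"
proof (rule absv_sums_le[OF nonarch_sums_diff[OF Psi_sums Psi_sums]])
  fix n
  have "absv ((u + h) ^ n - u ^ n) \<le> absv h"
    using absv_power_diff_le[of "u + h" 1 u n] assms by (simp add: absv_add_leI)
  then have "absv (fps_nth (Psi_series p :: 'a fps) n * ((u + h) ^ n - u ^ n)) \<le> 1 * absv h"
    unfolding absv_mult by (intro mult_mono absv_Psi_series_le_one) simp_all
  then show "absv (fps_nth (Psi_series p :: 'a fps) n * (u + h) ^ n - fps_nth (Psi_series p) n * u ^ n)
      \<le> absv h"
    by (simp add: right_diff_distrib)
qed

lemma p_power_absv_le:
  fixes h :: 'a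
  assumes "1 \<le> j" "absv h \<le> 1"
  shows "absv h / real p ^ j \<le> 1 / real p" "absv h / real p ^ j \<le> absv h"
proof -
  have "real p ^ 1 \<le> real p ^ j" using assms real_p_gt_1 by (intro power_increasing) auto
  then show "absv h / real p ^ j \<le> 1 / real p"
    using assms real_p_gt_1 by (intro frac_le) auto
  have "absv h * 1 \<le> absv h * real p ^ j"
    using real_p_gt_1 by (intro mult_left_mono one_le_power) simp_all
  then show "absv h / real p ^ j \<le> absv h"
    using real_p_gt_1 by (simp add: divide_le_eq)
qed

text \<open>For j >= 1 induction bounds the difference of the values at p^j(u + h) and p^j u by
  |h|/p^j <= 1/p; the p^j-th power gains another p^{-j}, which cancels the denominator. Assuming
  integrality along all p^j u, instead of u in Q_p, lets the lemma serve first for Q_p and then for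
  the whole strip of width 1.\<close>

lemma Psi_lipschitz_one:
  fixes u h :: 'a
  assumes "\<And>j. absv (Psi p (of_nat p ^ j * u)) \<le> 1" "absv h \<le> 1"
  shows "absv (Psi p (u + h) - Psi p u) \<le> absv h"
proof -
  obtain N where "absv (of_nat p ^ N * u) \<le> 1" by (rule p_power_mult_small)
  then show ?thesis using assms
  proof (induction N arbitrary: u h)
    case 0
    then show ?case by (intro Psi_lipschitz_unit_disc) simp_all
  next
    case (Suc N)
    show ?case
    proof (rule Psi_diff_le)
      fix j :: nat assume j: "1 \<le> j"
      note small = p_power_absv_le[OF j Suc.prems(3)]
      have absv_h: "absv (of_nat p ^ j * h) = absv h / real p ^ j"
        unfolding absv_mult absv_p_power by simp
      have "absv (Psi p (of_nat p ^ j * u + of_nat p ^ j * h) - Psi p (of_nat p ^ j * u))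
          \<le> absv (of_nat p ^ j * h)"
      proof (rule Suc.IH)
        obtain i where i: "j = Suc i" using j by (cases j) auto
        have "of_nat p ^ N * (of_nat p ^ j * u) = of_nat p ^ i * (of_nat p ^ Suc N * u)"
          by (simp add: mult_ac i)
        moreover have "absv (of_nat p ^ i :: 'a) \<le> 1"
          unfolding absv_p_power using real_p_gt_1 by simp
        ultimately show "absv (of_nat p ^ N * (of_nat p ^ j * u)) \<le> 1"
          using mult_mono[of "absv (of_nat p ^ i :: 'a)" 1 "absv (of_nat p ^ Suc N * u)" 1] Suc.prems(1)
          by (simp only: absv_mult) simp
        show "absv (Psi p (of_nat p ^ i * (of_nat p ^ j * u))) \<le> 1" for i
          using Suc.prems(2)[of "i + j"] by (simp add: power_add mult.assoc)
        show "absv (of_nat p ^ j * h) \<le> 1"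
          unfolding absv_h using small(2) Suc.prems(3) by linarith
      qed
      then have "absv (Psi p (of_nat p ^ j * (u + h)) - Psi p (of_nat p ^ j * u))
          \<le> absv h / real p ^ j"
        unfolding absv_h by (simp add: distrib_left)
      then have "absv (Psi p (of_nat p ^ j * (u + h)) ^ (p ^ j) - Psi p (of_nat p ^ j * u) ^ (p ^ j))
          \<le> absv h / real p ^ j / real p ^ j"
        by (rule frobenius_power_contracts[OF Suc.prems(2) _ small(1)])
      then have "real p ^ j *
          absv (Psi p (of_nat p ^ j * (u + h)) ^ (p ^ j) - Psi p (of_nat p ^ j * u) ^ (p ^ j))
          \<le> absv h / real p ^ j"
        using real_p_gt_1 by (simp add: field_simps)
      then show "real p ^ j *
          absv (Psi p (of_nat p ^ j * (u + h)) ^ (p ^ j) - Psi p (of_nat p ^ j * u) ^ (p ^ j))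
          \<le> absv h"
        using small(2) by linarith
    qed simp
  qed
qed

section \<open>Estimates on strips\<close>

lemma absv_p_power_mult: "absv (of_nat p ^ j * (h::'a)) = absv h / real p ^ j"
  unfolding absv_mult absv_p_power by simp

lemma absv_p_power_mult_le: "absv (of_nat p ^ j * (h::'a)) \<le> absv h"
proof -
  have "absv h * 1 \<le> absv h * real p ^ j"
    using real_p_gt_1 by (intro mult_left_mono one_le_power) simp_all
  then show ?thesis unfolding absv_p_power_mult using real_p_gt_1 by (simp add: divide_le_eq)
qed

lemma padic_strip_iff:
  "(u::'a) \<in> padic_strip \<rho> \<longleftrightarrow> (\<exists>x\<in>padic_numbers. absv (u - x) \<le> \<rho>)"
  by (auto simp: padic_strip_def dist_absv absv_minus_commute)

text \<open>Multiplication by p^j preserves Q_p, so it shrinks distances to Q_p; this is the descent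
  behind the induction on the width.\<close>

lemma padic_strip_scale:
  assumes "(u::'a) \<in> padic_strip (real p ^ (j + k))"
  shows "of_nat p ^ j * u \<in> padic_strip (real p ^ k)"
proof -
  obtain x where x: "x \<in> padic_numbers" "absv (u - x) \<le> real p ^ (j + k)"
    using assms unfolding padic_strip_iff by blast
  have "absv (of_nat p ^ j * u - of_nat p ^ j * x) \<le> real p ^ k"
    unfolding right_diff_distrib[symmetric] absv_p_power_mult
    using x(2) real_p_gt_1 by (simp add: divide_le_eq power_add mult.commute)
  then show ?thesis
    unfolding padic_strip_iff using p_power_mult_padic_numbers[OF x(1)] by blast
qed

lemma padic_strip_mono: "\<rho> \<le> \<sigma> \<Longrightarrow> (padic_strip \<rho> :: 'a set) \<subseteq> padic_strip \<sigma>"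
  unfolding padic_strip_iff subset_iff by (meson order_trans)

lemma padic_strip_power_mono: "k \<le> l \<Longrightarrow> (padic_strip (real p ^ k) :: 'a set) \<subseteq> padic_strip (real p ^ l)"
  using real_p_gt_1 by (intro padic_strip_mono power_increasing) auto

lemma padic_strip_add:
  assumes "(u::'a) \<in> padic_strip \<rho>" "absv h \<le> \<rho>"
  shows "u + h \<in> padic_strip \<rho>"
proof -
  obtain x where x: "x \<in> padic_numbers" "absv (u - x) \<le> \<rho>"
    using assms unfolding padic_strip_iff by blast
  have "absv ((u - x) + h) \<le> \<rho>" using x(2) assms(2) by (rule absv_add_leI)
  then show ?thesis unfolding padic_strip_iff using x(1) by (auto simp: algebra_simps)
qed

lemma padic_numbers_subset_strip: "0 \<le> \<rho> \<Longrightarrow> padic_numbers \<subseteq> (padic_strip \<rho> :: 'a set)"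
  unfolding padic_strip_iff subset_iff by force

lemma Psi_unit_strip_bound:
  fixes u :: 'a
  assumes "u \<in> padic_strip 1"
  shows "absv (Psi p u) \<le> 1"
proof -
  obtain x where x: "x \<in> padic_numbers" "absv (u - x) \<le> 1"
    using assms unfolding padic_strip_iff by blast
  have "absv (Psi p (x + (u - x)) - Psi p x) \<le> absv (u - x)"
    by (rule Psi_lipschitz_one[OF absv_Psi_le_one[OF p_power_mult_padic_numbers] x(2)]) fact
  then have "absv ((Psi p u - Psi p x) + Psi p x) \<le> 1"
    using x(2) absv_Psi_le_one[OF x(1)] by (intro absv_add_leI) simp_all
  then show ?thesis by simp
qed

lemma Psi_unit_strip_lipschitz:
  fixes u h :: 'a
  assumes "u \<in> padic_strip 1" "absv h \<le> 1"
  shows "absv (Psi p (u + h) - Psi p u) \<le> absv h"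
proof (rule Psi_lipschitz_one[OF Psi_unit_strip_bound assms(2)])
  fix j
  have "u \<in> padic_strip (real p ^ (j + 0))"
    using assms(1) padic_strip_power_mono[of 0 j] by auto
  from padic_strip_scale[OF this] show "of_nat p ^ j * u \<in> padic_strip 1" by simp
qed

text \<open>Only p^j v has to be near Q_p, not v, so this covers the summands of high index at
  points of arbitrarily wide strips.\<close>

lemma Psi_unit_strip_power:
  fixes v h :: 'a
  assumes "of_nat p ^ j * v \<in> padic_strip 1" "absv (of_nat p ^ j * h) \<le> 1 / real p"
  shows "real p ^ j *
    absv (Psi p (of_nat p ^ j * (v + h)) ^ (p ^ j) - Psi p (of_nat p ^ j * v) ^ (p ^ j))
      \<le> absv (of_nat p ^ j * h)"
proof -
  have "absv (of_nat p ^ j * h) \<le> 1" using assms(2) inverse_p_less_1 by linarith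
  then have "absv (Psi p (of_nat p ^ j * (v + h)) - Psi p (of_nat p ^ j * v))
      \<le> absv (of_nat p ^ j * h)"
    using Psi_unit_strip_lipschitz[OF assms(1)] by (simp add: distrib_left)
  from frobenius_power_contracts[OF Psi_unit_strip_bound[OF assms(1)] this assms(2), of j]
  show ?thesis using real_p_gt_1 by (simp add: field_simps)
qed

text \<open>
  In the functional equation the summands with $j > k+1$ only see the strip of width 1, and the
  finitely many others see narrower strips, to which the induction hypothesis applies.
\<close>

lemma Psi_strip_bound_lipschitz:
  "\<exists>L\<ge>1. \<forall>u\<in>padic_strip (real p ^ k). absv (Psi p (u::'a)) \<le> L \<and>
     (\<forall>h. absv h \<le> 1 \<longrightarrow> absv (Psi p (u + h) - Psi p u) \<le> L * absv h)"
proof (induction k)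
  case 0
  then show ?case using Psi_unit_strip_bound Psi_unit_strip_lipschitz by (intro exI[of _ 1]) simp
next
  case (Suc k)
  then obtain L where L: "1 \<le> L"
    and bound: "\<And>u. u \<in> padic_strip (real p ^ k) \<Longrightarrow> absv (Psi p (u::'a)) \<le> L"
    and lip: "\<And>u h. u \<in> padic_strip (real p ^ k) \<Longrightarrow> absv h \<le> 1 \<Longrightarrow>
        absv (Psi p (u + h) - Psi p (u::'a)) \<le> L * absv h"
    by blast
  \<comment> \<open>p^(k+1) bounds the denominators with j <= k+1, L^(p^(k+1)) the corresponding
    powers of values, and the last L is the Lipschitz constant of the narrower strip.\<close>
  define M where "M = real p ^ Suc k * (L ^ (p ^ Suc k) * L)"
  have pk: "1 \<le> real p ^ Suc k" using real_p_gt_1 by (intro one_le_power) simp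
  have Lq: "1 \<le> L ^ (p ^ Suc k)" using L by (rule one_le_power)
  have LqL: "L ^ (p ^ Suc k) \<le> L ^ (p ^ Suc k) * L" using mult_left_mono[OF L] Lq by simp
  have M_ge: "real p ^ Suc k * L ^ (p ^ Suc k) \<le> M"
    unfolding M_def using LqL pk by (intro mult_left_mono) linarith+
  moreover have "real p ^ Suc k * 1 \<le> real p ^ Suc k * L ^ (p ^ Suc k)"
    using Lq pk by (intro mult_left_mono) linarith+
  ultimately have M_p: "real p ^ Suc k \<le> M" and M1: "1 \<le> M" using pk by linarith+
  have scaled: "of_nat p ^ j * u \<in> padic_strip (real p ^ k)"
    if "u \<in> padic_strip (real p ^ Suc k)" "1 \<le> j" for u :: 'a and j
  proof -
    have "u \<in> padic_strip (real p ^ (j + k))"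
      using that padic_strip_power_mono[of "Suc k" "j + k"] by auto
    then show ?thesis by (rule padic_strip_scale)
  qed
  have unit: "of_nat p ^ j * u \<in> padic_strip 1"
    if "u \<in> padic_strip (real p ^ Suc k)" "Suc k \<le> j" for u :: 'a and j
  proof -
    have "u \<in> padic_strip (real p ^ (j + 0))"
      using that padic_strip_power_mono[of "Suc k" "j + 0"] by auto
    from padic_strip_scale[OF this] show ?thesis by simp
  qed
  have "absv (Psi p u) \<le> M" if u: "u \<in> padic_strip (real p ^ Suc k)" for u :: 'a
  proof -
    obtain x where x: "x \<in> padic_numbers" "absv (u - x) \<le> real p ^ Suc k"
      using u unfolding padic_strip_iff by blast
    have "absv (Psi p u - Psi p x) \<le> M"
    proof (rule Psi_diff_le)
      show "absv (u - x) \<le> M" using x(2) M_p by linarith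
      fix j :: nat assume j: "1 \<le> j"
      show "real p ^ j *
          absv (Psi p (of_nat p ^ j * u) ^ (p ^ j) - Psi p (of_nat p ^ j * x) ^ (p ^ j)) \<le> M"
      proof (cases "j \<le> Suc k")
        case True
        have power: "absv (Psi p (of_nat p ^ j * v) ^ (p ^ j)) \<le> L ^ (p ^ Suc k)"
          if "v \<in> padic_strip (real p ^ Suc k)" for v :: 'a
        proof -
          have "absv (Psi p (of_nat p ^ j * v)) ^ (p ^ j) \<le> L ^ (p ^ j)"
            using bound[OF scaled[OF that j]] by (intro power_mono) auto
          also have "\<dots> \<le> L ^ (p ^ Suc k)"
            using L True p_ge_2 by (intro power_increasing) auto
          finally show ?thesis by (simp add: absv_power)
        qed
        have "x \<in> padic_strip (real p ^ Suc k)"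
          using x(1) padic_numbers_subset_strip[of "real p ^ Suc k"] pk by auto
        then have "absv (Psi p (of_nat p ^ j * u) ^ (p ^ j) - Psi p (of_nat p ^ j * x) ^ (p ^ j))
            \<le> L ^ (p ^ Suc k)"
          using power u by (intro absv_diff_leI)
        moreover have "real p ^ j \<le> real p ^ Suc k"
          using True real_p_gt_1 by (intro power_increasing) auto
        ultimately have "real p ^ j *
            absv (Psi p (of_nat p ^ j * u) ^ (p ^ j) - Psi p (of_nat p ^ j * x) ^ (p ^ j))
            \<le> real p ^ Suc k * L ^ (p ^ Suc k)"
          using pk by (intro mult_mono) auto
        then show ?thesis using M_ge by linarith
      next
        case False
        have "of_nat p ^ j * x \<in> padic_strip 1"
          using padic_numbers_subset_strip[of 1] p_power_mult_padic_numbers[OF x(1)] by auto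
        \<comment> \<open>Here j >= k+2, one more than the exponent of the width, which produces the
          1/p required for Frobenius contraction.\<close>
        moreover have small: "absv (of_nat p ^ j * (u - x)) \<le> 1 / real p"
        proof -
          have "absv (u - x) * real p \<le> real p ^ Suc k * real p"
            using x(2) by (intro mult_right_mono) simp_all
          also have "\<dots> = real p ^ Suc (Suc k)" by simp
          also have "\<dots> \<le> real p ^ j"
            using False real_p_gt_1 by (intro power_increasing) auto
          finally show ?thesis
            unfolding absv_p_power_mult using real_p_gt_1 by (simp add: field_simps)
        qed
        ultimately have "real p ^ j *
            absv (Psi p (of_nat p ^ j * (x + (u - x))) ^ (p ^ j) - Psi p (of_nat p ^ j * x) ^ (p ^ j))
            \<le> absv (of_nat p ^ j * (u - x))"
          by (rule Psi_unit_strip_power)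
        then show ?thesis using small inverse_p_less_1 M1 by simp
      qed
    qed
    moreover have "absv (Psi p x) \<le> M" using absv_Psi_le_one[OF x(1)] M1 by linarith
    ultimately have "absv ((Psi p u - Psi p x) + Psi p x) \<le> M" by (rule absv_add_leI)
    then show ?thesis by simp
  qed
  moreover have "absv (Psi p (u + h) - Psi p u) \<le> M * absv h"
    if u: "u \<in> padic_strip (real p ^ Suc k)" and h: "absv h \<le> 1" for u h :: 'a
  proof (rule Psi_diff_le)
    have h_le: "absv h \<le> M * absv h" using mult_right_mono[OF M1, of "absv h"] by simp
    then show "absv ((u + h) - u) \<le> M * absv h" by simp
    fix j :: nat assume j: "1 \<le> j"
    have uh: "u + h \<in> padic_strip (real p ^ Suc k)"
      using padic_strip_add[OF u] h pk by simp
    show "real p ^ j *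
        absv (Psi p (of_nat p ^ j * (u + h)) ^ (p ^ j) - Psi p (of_nat p ^ j * u) ^ (p ^ j))
        \<le> M * absv h"
    proof (cases "j \<le> Suc k")
      case True
      let ?y = "Psi p (of_nat p ^ j * u)" and ?z = "Psi p (of_nat p ^ j * (u + h))"
      have "absv (?z - ?y) \<le> L * absv (of_nat p ^ j * h)"
        using lip[OF scaled[OF u j], of "of_nat p ^ j * h"] absv_p_power_mult_le[of j h] h
        by (simp add: distrib_left)
      also have "\<dots> \<le> L * absv h" using absv_p_power_mult_le L by (intro mult_left_mono) auto
      finally have zy: "absv (?z - ?y) \<le> L * absv h" .
      have "absv (?z ^ (p ^ j) - ?y ^ (p ^ j)) \<le> L ^ (p ^ j) * absv (?z - ?y)"
        by (rule absv_power_diff_le[OF bound[OF scaled[OF uh j]] bound[OF scaled[OF u j]] L])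
      also have "\<dots> \<le> L ^ (p ^ Suc k) * (L * absv h)"
        using zy L True p_ge_2 by (intro mult_mono power_increasing) auto
      finally have "absv (?z ^ (p ^ j) - ?y ^ (p ^ j)) \<le> L ^ (p ^ Suc k) * (L * absv h)" .
      moreover have "real p ^ j \<le> real p ^ Suc k"
        using True real_p_gt_1 by (intro power_increasing) auto
      ultimately have "real p ^ j * absv (?z ^ (p ^ j) - ?y ^ (p ^ j))
          \<le> real p ^ Suc k * (L ^ (p ^ Suc k) * (L * absv h))"
        using pk by (intro mult_mono) auto
      then show ?thesis by (simp add: M_def mult_ac)
    next
      case False
      have "absv (of_nat p ^ j * h) \<le> 1 / real p"
        unfolding absv_p_power_mult using p_power_absv_le(1)[OF j h] .
      from Psi_unit_strip_power[OF unit[OF u] this] False absv_p_power_mult_le[of j h] h_le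
      show ?thesis by (simp del: of_nat_power)
    qed
  qed
  ultimately show ?case using M1 by blast
qed

section \<open>The claims of the theorem\<close>

lemma padic_strip_subset_power: obtains k where "(padic_strip \<rho> :: 'a set) \<subseteq> padic_strip (real p ^ k)"
  using p_power_exceeds[of \<rho>] padic_strip_mono less_imp_le by metis

lemma Psi_bounded_on_strip: "bounded ((Psi p :: 'a \<Rightarrow> 'a) ` padic_strip \<rho>)"
proof -
  obtain k where k: "(padic_strip \<rho> :: 'a set) \<subseteq> padic_strip (real p ^ k)"
    by (rule padic_strip_subset_power)
  obtain L where "\<forall>u\<in>padic_strip (real p ^ k). absv (Psi p (u::'a)) \<le> L"
    using Psi_strip_bound_lipschitz by blast
  then have "\<forall>y\<in>(Psi p :: 'a \<Rightarrow> 'a) ` padic_strip \<rho>. dist 0 y \<le> L"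
    using k by (auto simp: dist_absv)
  then show ?thesis unfolding bounded_def by blast
qed

lemma Psi_uniformly_continuous_on_strip:
  "uniformly_continuous_on (padic_strip \<rho>) (Psi p :: 'a \<Rightarrow> 'a)"
  unfolding uniformly_continuous_on_def
proof (intro allI impI)
  fix e :: real assume e: "0 < e"
  obtain k where k: "(padic_strip \<rho> :: 'a set) \<subseteq> padic_strip (real p ^ k)"
    by (rule padic_strip_subset_power)
  obtain L where L: "1 \<le> L" and lip: "\<And>u h. u \<in> padic_strip (real p ^ k) \<Longrightarrow> absv h \<le> 1 \<Longrightarrow>
      absv (Psi p (u + h) - Psi p (u::'a)) \<le> L * absv h"
    using Psi_strip_bound_lipschitz by blast
  have "dist (Psi p v) (Psi p u) < e"
    if "u \<in> padic_strip \<rho>" "dist v u < min 1 (e / L)" for u v :: 'a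
  proof -
    have "absv (Psi p (u + (v - u)) - Psi p u) \<le> L * absv (v - u)"
      using that k by (intro lip) (auto simp: dist_absv)
    also have "\<dots> < L * (e / L)"
      using that L by (intro mult_strict_left_mono) (auto simp: dist_absv)
    finally show ?thesis using L by (simp add: dist_absv)
  qed
  then show "\<exists>d>0. \<forall>u\<in>padic_strip \<rho>. \<forall>v\<in>padic_strip \<rho>.
      dist v u < d \<longrightarrow> dist (Psi p v) (Psi p (u::'a)) < e"
    using e L by (intro exI[of _ "min 1 (e / L)"]) auto
qed

lemma Psi_series_in_Hbd: "(Psi_series p :: 'a fps) \<in> Hbd"
proof -
  have "fps_nth (Psi_series p :: 'a fps) n \<in> padic_numbers" for n
    by (simp add: fps_of_int_coeffs_def of_int_in_padic_numbers)
  then show ?thesis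
    using Psi_bounded_on_strip fps_entire_Psi_series
    by (auto simp: Hbd_def Hbd_width_def Psi_def)
qed

text \<open>Here the Lipschitz constant has to be exactly 1: after division by p^j it gives |w| <=
  |z|, while a larger constant would enlarge the target disc.\<close>

lemma Psi_maps_discs:
  fixes x :: 'a
  assumes "x \<in> padic_numbers"
  shows "Psi p ` ((\<lambda>z. x + of_nat p ^ j * z) ` cball 0 1)
    \<subseteq> (\<lambda>z. Psi p x + of_nat p ^ j * z) ` cball 0 1"
proof -
  have "Psi p (x + of_nat p ^ j * z) \<in> (\<lambda>z. Psi p x + of_nat p ^ j * z) ` cball 0 1"
    if "absv z \<le> 1" for z :: 'a
  proof
    define w where "w = (Psi p (x + of_nat p ^ j * z) - Psi p x) / of_nat p ^ j"
    have "x \<in> padic_strip 1" using assms padic_numbers_subset_strip[of 1] by auto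
    moreover have "absv (of_nat p ^ j * z) \<le> 1"
      using absv_p_power_mult_le[of j z] that by linarith
    ultimately have "absv (Psi p (x + of_nat p ^ j * z) - Psi p x) \<le> absv (of_nat p ^ j * z)"
      by (rule Psi_unit_strip_lipschitz)
    then have "absv w * (1 / real p ^ j) \<le> absv z / real p ^ j"
      unfolding w_def absv_divide absv_p_power absv_p_power_mult using real_p_gt_1 by simp
    then have "absv w \<le> 1" using that real_p_gt_1 by (simp add: divide_le_cancel)
    then show "w \<in> cball 0 1" by (simp add: dist_absv)
    show "Psi p (x + of_nat p ^ j * z) = Psi p x + of_nat p ^ j * w"
      using of_nat_p_nonzero by (simp add: w_def)
  qed
  then show ?thesis by (auto simp: dist_absv)
qed

end

theorem theorem3p11:
  fixes p :: nat
  assumes "prime p"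
    and "is_padic_complex_field p TYPE('a::nonarch_field)"
  shows "((\<forall>\<rho>>0. bounded ((Psi p :: 'a \<Rightarrow> 'a) ` padic_strip \<rho>) \<and>
                 uniformly_continuous_on (padic_strip \<rho>) (Psi p :: 'a \<Rightarrow> 'a)) \<and>
          (fps_of_int_coeffs (Psi_fps p) :: 'a fps) \<in> Hbd) \<and>
         (\<forall>(j::nat) (x::'a). x \<in> padic_numbers \<longrightarrow>
            Psi p ` ((\<lambda>z. x + of_nat p ^ j * z) ` cball 0 1)
              \<subseteq> (\<lambda>z. Psi p x + of_nat p ^ j * z) ` cball 0 1)"
  using Psi_bounded_on_strip[OF assms] Psi_uniformly_continuous_on_strip[OF assms]
    Psi_series_in_Hbd[OF assms] Psi_maps_discs[OF assms]
  by blast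

end
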